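(* The following statements are equivalent for a set $A\subseteq\omega$: (1) $A$ computes a function $f:\omega\to\omega$ that is eventually always different from each recursive function, i.e. for every recursive $h:\omega\to\omega$ the set $\{x:f(x)=h(x)\}$ is finite. (2) $A$ computes a function $g:\omega\to\omega$ such that either $g$ dominates each recursive function or $g$ is eventually always different from each partial recursive function (i.e. for every partial recursive $\psi$ the set $\{x:\psi(x)\text{ is defined and }\psi(x)=g(x)\}$ is finite). (3) $A$ is of high or DNR Turing degree. (4) $A$ computes an unbounded function $f:\{0,1\}^*\to\omega$ which is dominated by all recursive upper bounds on $C$. (5) $A$ computes a function $F$ on $\omega$ such that for every total recursive function $V$ with domain $\{0,1\}^*$ and almost all $n$, $F(n)\notin\{V(p):p\in\{0,1\}^*\wedge|p|<n\}$.
   Context: Fix an acceptable numbering $\varphi_0,\varphi_1,\dots$ of the partial recursive functions. $C$ denotes plain Kolmogorov complexity with respect to a fixed universal machine on binary strings; natural numbers and binary strings are identified in a standard computable way when needed. A function $u$ dominates a function $v$ if $u(x)\ge v(x)$ for all but finitely many $x$. A recursive upper bound on $C$ is a total recursive function $\tilde C:\{0,1\}^*\to\omega$ with $C(x)\le\tilde C(x)$ for all $x$. A set $A$ has high Turing degree if $A$ computes a function dominating every recursive function (equivalently, $A'\ge_T\emptyset''$). A total function $f:\omega\to\omega$ is diagonally nonrecursive (DNR) if $f(x)\neq\varphi_x(x)$ for every $x$ with $\varphi_x(x)$ defined. $A$ has DNR Turing degree if $A$ computes a DNR function. *)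

theory Defs
  imports Main
begin

section \<open>Partial recursive functions relative to a set\<close>

text \<open>
  Codes for the functions obtained from the initial functions and the characteristic function of
  a set by composition, primitive recursion and minimisation (Kleene). The recursion variable and
  the search variable are the first argument. Codes carry no arity: a code applied to an argument
  list for which no rule below fits is undefined there.
\<close>

datatype code =
    Zero
  | Succ
  | Proj nat
  | Query
  | Comp code "code list"
  | PrimRec code code
  | Mu code

inductive runs :: "nat set \<Rightarrow> code \<Rightarrow> nat list \<Rightarrow> nat \<Rightarrow> bool" for A where
  runs_Zero: "runs A Zero xs 0"
| runs_Succ: "runs A Succ [x] (Suc x)"
| runs_Proj: "i < length xs \<Longrightarrow> runs A (Proj i) xs (xs ! i)"
| runs_Query: "runs A Query [x] (if x \<in> A then 1 else 0)"
| runs_Comp: "list_all2 (\<lambda>g y. runs A g xs y) gs ys \<Longrightarrow> runs A f ys z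
    \<Longrightarrow> runs A (Comp f gs) xs z"
| runs_PrimRec_0: "runs A f xs y \<Longrightarrow> runs A (PrimRec f g) (0 # xs) y"
| runs_PrimRec_Suc: "runs A (PrimRec f g) (n # xs) y \<Longrightarrow> runs A g (n # y # xs) z
    \<Longrightarrow> runs A (PrimRec f g) (Suc n # xs) z"
| runs_Mu: "\<forall>i<n. \<exists>y. runs A f (i # xs) (Suc y) \<Longrightarrow> runs A f (n # xs) 0
    \<Longrightarrow> runs A (Mu f) xs n"

inductive_cases runs_ZeroE: "runs A Zero xs y"
inductive_cases runs_SuccE: "runs A Succ [x] y"
inductive_cases runs_ProjE: "runs A (Proj i) xs y"
inductive_cases runs_QueryE: "runs A Query [x] y"
inductive_cases runs_CompE: "runs A (Comp f gs) xs y"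
inductive_cases runs_PrimRec_0E: "runs A (PrimRec f g) (0 # xs) y"
inductive_cases runs_PrimRec_SucE: "runs A (PrimRec f g) (Suc n # xs) y"
inductive_cases runs_MuE: "runs A (Mu f) xs y"

lemma runs_deterministic: "runs A c xs y \<Longrightarrow> runs A c xs z \<Longrightarrow> y = z"
proof (induction arbitrary: z rule: runs.induct)
  case (runs_Comp xs gs ys f w)
  from runs_Comp.prems obtain ys' where
    ys': "list_all2 (\<lambda>g y. runs A g xs y) gs ys'" "runs A f ys' z"
    by (blast elim: runs_CompE)
  have "ys = ys'"
    using runs_Comp.IH(1) ys'(1) by (auto simp: list_all2_conv_all_nth intro!: nth_equalityI)
  then show ?case using runs_Comp.IH(2) ys'(2) by blast
next
  case (runs_PrimRec_Suc f g n xs y w)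
  from runs_PrimRec_Suc.prems show ?case
    by (blast elim: runs_PrimRec_SucE dest: runs_PrimRec_Suc.IH)
next
  case (runs_Mu n f xs)
  from runs_Mu.prems have 1: "\<forall>i<z. \<exists>y. runs A f (i # xs) (Suc y)" and 2: "runs A f (z # xs) 0"
    by (blast elim: runs_MuE)+
  show ?case
  proof (rule linorder_cases[of n z])
    assume "n < z"
    with 1 runs_Mu.IH(2) show ?thesis by blast
  next
    assume "z < n"
    with 2 runs_Mu.IH(1) show ?thesis by blast
  qed
qed (blast elim: runs_ZeroE runs_SuccE runs_ProjE runs_QueryE runs_PrimRec_0E)+

definition computes :: "nat set \<Rightarrow> (nat \<Rightarrow> nat) \<Rightarrow> bool" where
  "computes A f \<longleftrightarrow> (\<exists>c. \<forall>x. runs A c [x] (f x))"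

text \<open>Without relativisation: the set is empty, so that \<open>Query\<close> is the constant 0.\<close>

definition partial_recursive :: "(nat \<Rightarrow> nat option) \<Rightarrow> bool" where
  "partial_recursive \<psi> \<longleftrightarrow> (\<exists>c. \<forall>x y. \<psi> x = Some y \<longleftrightarrow> runs {} c [x] y)"

definition partial_recursive2 :: "(nat \<Rightarrow> nat \<Rightarrow> nat option) \<Rightarrow> bool" where
  "partial_recursive2 \<psi> \<longleftrightarrow> (\<exists>c. \<forall>e x y. \<psi> e x = Some y \<longleftrightarrow> runs {} c [e, x] y)"

definition recursive :: "(nat \<Rightarrow> nat) \<Rightarrow> bool" where
  "recursive f \<longleftrightarrow> partial_recursive (\<lambda>x. Some (f x))"

text \<open>
  A numbering is acceptable if it is uniformly partial recursive and every uniformly partial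
  recursive family of functions can be translated into it recursively.
\<close>

definition acceptable_numbering :: "(nat \<Rightarrow> nat \<Rightarrow> nat option) \<Rightarrow> bool" where
  "acceptable_numbering \<phi> \<longleftrightarrow>
     partial_recursive2 \<phi> \<and>
     (\<forall>\<psi>. partial_recursive2 \<psi> \<longrightarrow> (\<exists>s. recursive s \<and> (\<forall>e. \<phi> (s e) = \<psi> e)))"

section \<open>Binary strings and plain Kolmogorov complexity\<close>

text \<open>
  Bijective base-2 numeration, with the first letter of the string least significant. It
  enumerates the strings in order of their length.
\<close>

fun nat_of_str :: "bool list \<Rightarrow> nat" where
  "nat_of_str [] = 0"
| "nat_of_str (b # bs) = 2 * nat_of_str bs + (if b then 2 else 1)"

lemma bij_nat_of_str: "bij nat_of_str"
proof (rule bijI)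
  show "inj nat_of_str"
  proof (rule injI)
    fix p q :: "bool list"
    assume "nat_of_str p = nat_of_str q"
    then show "p = q"
    proof (induction p arbitrary: q)
      case Nil
      then show ?case by (cases q) (auto split: if_splits)
    next
      case (Cons b p)
      then obtain b' q' where q: "q = b' # q'"
        by (cases q) (auto split: if_splits)
      have eq: "2 * nat_of_str p + (if b then 2 else 1) = 2 * nat_of_str q' + (if b' then 2 else 1)"
        using Cons.prems q by simp
      have "b = b'"
        using eq by (cases b; cases b'; simp; presburger)
      with eq Cons.IH q show ?case by auto
    qed
  qed
  have "\<exists>p. nat_of_str p = n" for n
  proof (induction n rule: less_induct)
    case (less n)
    show ?case
    proof (cases "n = 0")
      case True
      then show ?thesis by (metis nat_of_str.simps(1))
    next
      case False
      then obtain p where p: "nat_of_str p = (n - 1) div 2"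
        using less[of "(n - 1) div 2"] by fastforce
      have "nat_of_str (even n # p) = n"
        using p False by (auto elim!: oddE evenE)
      then show ?thesis by blast
    qed
  qed
  then show "surj nat_of_str" by (metis surjI)
qed

definition str_of_nat :: "nat \<Rightarrow> bool list" where
  "str_of_nat = inv nat_of_str"

definition str_computes :: "nat set \<Rightarrow> (bool list \<Rightarrow> nat) \<Rightarrow> bool" where
  "str_computes A f \<longleftrightarrow> computes A (\<lambda>n. f (str_of_nat n))"

definition str_recursive :: "(bool list \<Rightarrow> nat) \<Rightarrow> bool" where
  "str_recursive f \<longleftrightarrow> recursive (\<lambda>n. f (str_of_nat n))"

definition str_machine :: "(bool list \<Rightarrow> bool list option) \<Rightarrow> bool" where
  "str_machine M \<longleftrightarrow> partial_recursive (\<lambda>n. map_option nat_of_str (M (str_of_nat n)))"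

definition universal_machine :: "(bool list \<Rightarrow> bool list option) \<Rightarrow> bool" where
  "universal_machine U \<longleftrightarrow>
     str_machine U \<and>
     (\<forall>M. str_machine M \<longrightarrow>
       (\<exists>d. \<forall>p x. M p = Some x \<longrightarrow> (\<exists>q. U q = Some x \<and> length q \<le> length p + d)))"

text \<open>For universal \<open>U\<close> every string has a description, so the minimum is attained.\<close>

definition plain_complexity :: "(bool list \<Rightarrow> bool list option) \<Rightarrow> bool list \<Rightarrow> nat" where
  "plain_complexity U x = (LEAST k. \<exists>p. U p = Some x \<and> length p = k)"

definition recursive_upper_bound ::
    "(bool list \<Rightarrow> bool list option) \<Rightarrow> (bool list \<Rightarrow> nat) \<Rightarrow> bool" where
  "recursive_upper_bound U B \<longleftrightarrow> str_recursive B \<and> (\<forall>x. plain_complexity U x \<le> B x)"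

section \<open>Domination, high and DNR degrees\<close>

definition dominates :: "('a \<Rightarrow> nat) \<Rightarrow> ('a \<Rightarrow> nat) \<Rightarrow> bool" where
  "dominates u v \<longleftrightarrow> finite {x. \<not> u x \<ge> v x}"

definition high_degree :: "nat set \<Rightarrow> bool" where
  "high_degree A \<longleftrightarrow> (\<exists>g. computes A g \<and> (\<forall>h. recursive h \<longrightarrow> dominates g h))"

definition dnr :: "(nat \<Rightarrow> nat \<Rightarrow> nat option) \<Rightarrow> (nat \<Rightarrow> nat) \<Rightarrow> bool" where
  "dnr \<phi> f \<longleftrightarrow> (\<forall>x y. \<phi> x x = Some y \<longrightarrow> f x \<noteq> y)"

definition dnr_degree :: "(nat \<Rightarrow> nat \<Rightarrow> nat option) \<Rightarrow> nat set \<Rightarrow> bool" where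
  "dnr_degree \<phi> A \<longleftrightarrow> (\<exists>f. computes A f \<and> dnr \<phi> f)"

end

theory Submission
  imports Defs "HOL-Library.Nat_Bijection"
begin

text \<open>
  The implications shown are (1) to (3) to (2) to (1), and (2) to (4) to (5) to (1).

  (1) to (3): If \<open>A\<close> is not DNR, then every \<open>x \<mapsto> f \<langle>n, x\<rangle>\<close> agrees somewhere with the diagonal
  function \<open>x \<mapsto> \<phi>\<^sub>x(x)\<close>. If \<open>A\<close> is moreover not high, a recursive function bounds, for infinitely
  many \<open>n\<close>, the stage at which this agreement is seen; the diagonal function stopped at that stage
  is recursive and agrees with \<open>f\<close> infinitely often.

  (3) to (2): From a DNR function, \<open>n + 1\<close> of its values together form a number different from
  \<open>\<phi>\<^sub>e(n)\<close> for all \<open>e \<le> n\<close>, the \<open>e\<close>-th value differing from the \<open>e\<close>-th component of \<open>\<phi>\<^sub>e(n)\<close>.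

  (2) to (4): If \<open>g\<close> dominates the recursive functions, the approximation of \<open>C(x)\<close> at stage \<open>g(x)\<close>
  is eventually below every recursive upper bound, since the latter is recursively witnessed.
  If \<open>g\<close> is different from every partial recursive function, then the tuple \<open>F(n)\<close> of \<open>2\<^sup>n\<close> values
  of \<open>g\<close> avoids the outputs of all programs shorter than \<open>n\<close>, so that \<open>C \<langle>n, F(n)\<rangle> \<ge> n\<close>.

  (4) to (5): Let \<open>F(n)\<close> be the first \<open>x\<close> with \<open>f(x) \<ge> 2n\<close>. Every total \<open>V\<close> yields a recursive upper
  bound on \<open>C\<close> that is at most \<open>|p| + O(1)\<close> at \<open>V(p)\<close>.

  (5) to (1): Apply (5) to \<open>V(p) = h(|p| + 1)\<close>.
\<close>

section \<open>Total computable functions of several arguments\<close>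

text \<open>All arguments form one list, so that the closure rules below apply to terms
  \<open>\<lambda>xs. F xs\<close> by \<open>intro\<close>. The arity is explicit because primitive
  recursion and quantifiers put further arguments in front.\<close>

definition computable :: "nat set \<Rightarrow> nat \<Rightarrow> (nat list \<Rightarrow> nat) \<Rightarrow> bool" where
  "computable A n F \<longleftrightarrow> (\<exists>c. \<forall>xs. length xs = n \<longrightarrow> runs A c xs (F xs))"

definition decidable :: "nat set \<Rightarrow> nat \<Rightarrow> (nat list \<Rightarrow> bool) \<Rightarrow> bool" where
  "decidable A n P \<longleftrightarrow> computable A n (\<lambda>xs. if P xs then 1 else 0)"

named_theorems computable_intros

section \<open>Composition, projections and primitive recursion\<close>

lemma computable_cong:
  "computable A n F \<Longrightarrow> (\<And>xs. length xs = n \<Longrightarrow> F xs = G xs) \<Longrightarrow> computable A n G"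
  unfolding computable_def by metis

lemma decidable_cong:
  "decidable A n P \<Longrightarrow> (\<And>xs. length xs = n \<Longrightarrow> P xs = Q xs) \<Longrightarrow> decidable A n Q"
  unfolding decidable_def by (erule computable_cong) simp

lemma computable_compose:
  assumes "computable A (length Gs) F" and "\<And>G. G \<in> set Gs \<Longrightarrow> computable A n G"
  shows "computable A n (\<lambda>xs. F (map (\<lambda>G. G xs) Gs))"
proof -
  obtain f where f: "\<And>xs. length xs = length Gs \<Longrightarrow> runs A f xs (F xs)"
    using assms(1) unfolding computable_def by blast
  obtain g where g: "\<And>G xs. G \<in> set Gs \<Longrightarrow> length xs = n \<Longrightarrow> runs A (g G) xs (G xs)"
    using assms(2) unfolding computable_def by metis
  have "runs A (Comp f (map g Gs)) xs (F (map (\<lambda>G. G xs) Gs))" if "length xs = n" for xs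
    by (rule runs_Comp[where ys = "map (\<lambda>G. G xs) Gs"])
      (auto simp: list_all2_conv_all_nth f g that)
  then show ?thesis unfolding computable_def by blast
qed

lemma computable_nth [computable_intros]: "i < n \<Longrightarrow> computable A n (\<lambda>xs. xs ! i)"
  unfolding computable_def by (metis runs_Proj)

text \<open>Under a recursion or a bounded quantifier the parameters appear as
  \<open>drop 2 l\<close>, under minimisation as \<open>drop 1 l\<close>; this rule reaches them
  there.\<close>

lemma computable_nth_drop [computable_intros]:
  "k + i < n \<Longrightarrow> computable A n (\<lambda>xs. drop k xs ! i)"
  by (rule computable_cong[OF computable_nth[of "k + i"]]) auto

lemma computable_nth_drop_drop [computable_intros]:
  "j + k + i < n \<Longrightarrow> computable A n (\<lambda>xs. drop j (drop k xs) ! i)"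
  using computable_nth_drop[of "j + k" i n A] by simp

lemma computable_compose1:
  assumes "computable A 1 (\<lambda>xs. f (xs ! 0))" and "computable A n F"
  shows "computable A n (\<lambda>xs. f (F xs))"
  using computable_compose[of A "[F]" "\<lambda>xs. f (xs ! 0)" n] assms by auto

lemma computable_compose2:
  assumes "computable A 2 (\<lambda>xs. f (xs ! 0) (xs ! 1))" and "computable A n F" and "computable A n G"
  shows "computable A n (\<lambda>xs. f (F xs) (G xs))"
  using computable_compose[of A "[F, G]" "\<lambda>xs. f (xs ! 0) (xs ! 1)" n] assms
  by (auto simp: numeral_2_eq_2)

lemma computable_Suc [computable_intros]:
  assumes "computable A n F" shows "computable A n (\<lambda>xs. Suc (F xs))"
proof (rule computable_compose1[OF _ assms])
  have "runs A Succ xs (Suc (xs ! 0))" if "length xs = 1" for xs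
    using that by (cases xs) (auto intro: runs_Succ)
  then show "computable A 1 (\<lambda>xs. Suc (xs ! 0))" unfolding computable_def by blast
qed

lemma computable_zero: "computable A n (\<lambda>xs. 0)"
  unfolding computable_def by (blast intro: runs_Zero)

lemma computable_const [computable_intros]: "computable A n (\<lambda>xs. k)"
  by (induction k) (auto intro: computable_zero computable_Suc)

lemma map_project: "length xs = n \<Longrightarrow> map (\<lambda>i. xs ! i) [0..<n] = xs"
  by (metis map_nth)

lemma computable_rec [computable_intros]:
  assumes Z: "computable A n Z"
    and S: "computable A (Suc (Suc n)) (\<lambda>l. S (l ! 0) (l ! 1) (drop 2 l))"
    and N: "computable A n N"
  shows "computable A n (\<lambda>xs. rec_nat (Z xs) (\<lambda>k y. S k y xs) (N xs))"
proof -
  obtain z s where z: "\<And>xs. length xs = n \<Longrightarrow> runs A z xs (Z xs)"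
    and s: "\<And>xs. length xs = Suc (Suc n) \<Longrightarrow> runs A s xs (S (xs ! 0) (xs ! 1) (drop 2 xs))"
    using Z S unfolding computable_def by blast
  have "runs A (PrimRec z s) (m # xs) (rec_nat (Z xs) (\<lambda>k y. S k y xs) m)"
    if "length xs = n" for m xs
  proof (induction m)
    case 0
    then show ?case using that by (simp add: runs_PrimRec_0 z)
  next
    case (Suc m)
    have "runs A s (m # rec_nat (Z xs) (\<lambda>k y. S k y xs) m # xs)
        (rec_nat (Z xs) (\<lambda>k y. S k y xs) (Suc m))"
      using s[of "m # rec_nat (Z xs) (\<lambda>k y. S k y xs) m # xs"] that by simp
    then show ?case using Suc by (rule runs_PrimRec_Suc[rotated])
  qed
  then have "runs A (PrimRec z s) l
      (rec_nat (Z (drop 1 l)) (\<lambda>k y. S k y (drop 1 l)) (l ! 0))" if "length l = Suc n" for l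
    using that by (cases l) auto
  then have "computable A (Suc n) (\<lambda>l. rec_nat (Z (drop 1 l)) (\<lambda>k y. S k y (drop 1 l)) (l ! 0))"
    unfolding computable_def by blast
  \<comment> \<open>\<open>N\<close> supplies the recursion argument, and the projections behind it
    hand on the parameters.\<close>
  then have "computable A n (\<lambda>xs. (\<lambda>l. rec_nat (Z (drop 1 l)) (\<lambda>k y. S k y (drop 1 l)) (l ! 0))
      (map (\<lambda>G. G xs) (N # map (\<lambda>i xs. xs ! i) [0..<n])))"
    by (intro computable_compose) (auto intro: N computable_nth)
  then show ?thesis
    by (rule computable_cong) (auto simp: map_project comp_def)
qed

section \<open>Arithmetic functions\<close>

lemma computable_pred [computable_intros]:
  assumes "computable A n F" shows "computable A n (\<lambda>xs. F xs - 1)"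
proof -
  have "rec_nat 0 (\<lambda>k y. k) m = m - 1" for m :: nat by (cases m) auto
  moreover have "computable A n (\<lambda>xs. rec_nat 0 (\<lambda>k y. k) (F xs))"
    by (intro computable_intros assms) simp
  ultimately show ?thesis by simp
qed

lemma computable_add [computable_intros]:
  assumes "computable A n F" and "computable A n G" shows "computable A n (\<lambda>xs. F xs + G xs)"
proof -
  have "rec_nat a (\<lambda>k y. Suc y) m = a + m" for a m :: nat by (induction m) auto
  moreover have "computable A n (\<lambda>xs. rec_nat (F xs) (\<lambda>k y. Suc y) (G xs))"
    by (intro computable_intros assms) simp
  ultimately show ?thesis by simp
qed

lemma computable_diff [computable_intros]:
  assumes "computable A n F" and "computable A n G" shows "computable A n (\<lambda>xs. F xs - G xs)"
proof -
  have "rec_nat a (\<lambda>k y. y - 1) m = a - m" for a m :: nat by (induction m) auto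
  moreover have "computable A n (\<lambda>xs. rec_nat (F xs) (\<lambda>k y. y - 1) (G xs))"
    by (intro computable_rec computable_pred computable_nth assms) simp
  ultimately show ?thesis by simp
qed

lemma computable_drop_compose:
  assumes "computable A n F"
  shows "computable A (k + n) (\<lambda>xs. F (drop k xs))"
proof -
  have "computable A (k + n) (\<lambda>xs. F (map (\<lambda>G. G xs) (map (\<lambda>i xs. xs ! (k + i)) [0..<n])))"
    using assms by (intro computable_compose) (auto intro: computable_nth)
  then show ?thesis
    by (rule computable_cong) (auto intro!: arg_cong[of _ _ F] nth_equalityI)
qed

lemma computable_drop2: "computable A n F \<Longrightarrow> computable A (Suc (Suc n)) (\<lambda>xs. F (drop 2 xs))"
  using computable_drop_compose[of A n F 2] by simp

lemma computable_mult [computable_intros]: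
  assumes "computable A n F" and "computable A n G" shows "computable A n (\<lambda>xs. F xs * G xs)"
proof -
  have "rec_nat 0 (\<lambda>k y. y + a) m = a * m" for a m :: nat by (induction m) auto
  moreover have "computable A n (\<lambda>xs. rec_nat 0 (\<lambda>k y. y + F xs) (G xs))"
    by (intro computable_intros computable_drop2 assms) simp
  ultimately show ?thesis by simp
qed

lemma computable_power [computable_intros]:
  assumes "computable A n F" and "computable A n G" shows "computable A n (\<lambda>xs. F xs ^ G xs)"
proof -
  have "rec_nat 1 (\<lambda>k y. a * y) m = a ^ m" for a m :: nat by (induction m) auto
  moreover have "computable A n (\<lambda>xs. rec_nat 1 (\<lambda>k y. F xs * y) (G xs))"
    by (intro computable_intros computable_drop2 assms) simp
  ultimately show ?thesis by simp
qed

section \<open>Definition by cases, decidable predicates and bounded quantifiers\<close>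

lemma computable_if [computable_intros]:
  assumes "decidable A n P" and "computable A n F" and "computable A n G"
  shows "computable A n (\<lambda>xs. if P xs then F xs else G xs)"
proof -
  \<comment> \<open>Recursion over the truth value: at 0 the base value \<open>G xs\<close> remains,
    at 1 the single step returns \<open>F xs\<close>.\<close>
  have "computable A n (\<lambda>xs. rec_nat (G xs) (\<lambda>k y. F xs) (if P xs then 1 else 0))"
    by (intro computable_rec computable_drop2 assms assms(1)[unfolded decidable_def])
  then show ?thesis by (rule computable_cong) auto
qed

lemma decidable_le [computable_intros]:
  assumes "computable A n F" and "computable A n G" shows "decidable A n (\<lambda>xs. F xs \<le> G xs)"
proof -
  \<comment> \<open>The recursion gives 1 exactly if the truncated difference is 0.\<close>
  have "computable A n (\<lambda>xs. rec_nat 1 (\<lambda>k y. 0) (F xs - G xs))"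
    by (intro computable_intros assms)
  then show ?thesis unfolding decidable_def
    by (rule computable_cong) (metis diff_is_0_eq not0_implies_Suc old.nat.simps(6,7))
qed

lemma decidable_not [computable_intros]: "decidable A n P \<Longrightarrow> decidable A n (\<lambda>xs. \<not> P xs)"
  unfolding decidable_def[of _ _ "\<lambda>xs. \<not> P xs"]
  by (rule computable_cong[OF computable_if[where F = "\<lambda>_. 0" and G = "\<lambda>_. 1"]])
    (auto intro: computable_const)

lemma decidable_conj [computable_intros]:
  assumes P: "decidable A n P" and Q: "decidable A n Q"
  shows "decidable A n (\<lambda>xs. P xs \<and> Q xs)"
proof -
  have "computable A n (\<lambda>xs. if P xs then if Q xs then 1 else 0 else 0)"
    by (intro computable_if computable_const P Q)
  then show ?thesis unfolding decidable_def by (rule computable_cong) auto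
qed

lemma decidable_disj [computable_intros]:
  "decidable A n P \<Longrightarrow> decidable A n Q \<Longrightarrow> decidable A n (\<lambda>xs. P xs \<or> Q xs)"
  by (rule decidable_cong[OF decidable_not[OF decidable_conj[OF decidable_not decidable_not]]]) auto

lemma decidable_eq [computable_intros]:
  "computable A n F \<Longrightarrow> computable A n G \<Longrightarrow> decidable A n (\<lambda>xs. F xs = G xs)"
  by (rule decidable_cong[OF decidable_conj[OF decidable_le[of A n F G] decidable_le[of A n G F]]])
    auto

lemma decidable_less [computable_intros]:
  "computable A n F \<Longrightarrow> computable A n G \<Longrightarrow> decidable A n (\<lambda>xs. F xs < G xs)"
  by (rule decidable_cong[OF decidable_not[OF decidable_le[of A n G F]]]) auto

text \<open>The list \<open>l\<close> has the shape of a recursion step: \<open>l ! 0\<close> is the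
  quantified index and \<open>l ! 1\<close> the truth value accumulated so far, which
  \<open>P\<close> does not see.\<close>

lemma decidable_ex_less [computable_intros]:
  assumes P: "decidable A (Suc (Suc n)) (\<lambda>l. P (l ! 0) (drop 2 l))" and N: "computable A n N"
  shows "decidable A n (\<lambda>xs. \<exists>i<N xs. P i xs)"
proof -
  have "rec_nat (0 :: nat) (\<lambda>k y. if p k then 1 else y) m = (if \<exists>i<m. p i then 1 else 0)" for p m
    by (induction m) (auto simp: less_Suc_eq)
  moreover have "computable A n (\<lambda>xs. rec_nat 0 (\<lambda>k y. if P k xs then 1 else y) (N xs))"
    by (intro computable_intros P N) simp
  ultimately show ?thesis unfolding decidable_def by simp
qed

lemma decidable_ex_le [computable_intros]:
  assumes "decidable A (Suc (Suc n)) (\<lambda>l. P (l ! 0) (drop 2 l))" and "computable A n N"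
  shows "decidable A n (\<lambda>xs. \<exists>i\<le>N xs. P i xs)"
  using decidable_ex_less[OF assms(1) computable_Suc[OF assms(2)]] by (simp add: less_Suc_eq_le)

lemma decidable_all_less [computable_intros]:
  assumes "decidable A (Suc (Suc n)) (\<lambda>l. P (l ! 0) (drop 2 l))" and "computable A n N"
  shows "decidable A n (\<lambda>xs. \<forall>i<N xs. P i xs)"
  using decidable_not[OF decidable_ex_less[OF decidable_not[OF assms(1)] assms(2)]] by simp

text \<open>\<open>Mu\<close> searches for a zero, so it is applied to the characteristic function
  of the negation; the existence hypothesis makes the search terminate.\<close>

lemma computable_Least:
  assumes P: "decidable A (Suc n) (\<lambda>l. P (l ! 0) (drop 1 l))"
    and ex: "\<And>xs. length xs = n \<Longrightarrow> \<exists>k. P k xs"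
  shows "computable A n (\<lambda>xs. LEAST k. P k xs)"
proof -
  from decidable_not[OF P] obtain c where
    "\<And>l. length l = Suc n \<Longrightarrow> runs A c l (if \<not> P (l ! 0) (drop 1 l) then 1 else 0)"
    unfolding decidable_def computable_def by blast
  from this[of "_ # _"]
  have c: "\<And>k xs. length xs = n \<Longrightarrow> runs A c (k # xs) (if \<not> P k xs then 1 else 0)"
    by simp
  have "runs A (Mu c) xs (LEAST k. P k xs)" if len: "length xs = n" for xs
  proof (rule runs_Mu)
    show "runs A c ((LEAST k. P k xs) # xs) 0"
      using c[OF len, of "LEAST k. P k xs"] LeastI_ex[OF ex[OF len]] by simp
    show "\<forall>i<LEAST k. P k xs. \<exists>y. runs A c (i # xs) (Suc y)"
      using c[OF len] not_less_Least[of _ "\<lambda>k. P k xs"] by (metis One_nat_def)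
  qed
  then show ?thesis unfolding computable_def by blast
qed

section \<open>Unary functions and passage to an arbitrary oracle\<close>

lemma computes_iff_computable: "computes A f \<longleftrightarrow> computable A 1 (\<lambda>xs. f (xs ! 0))"
proof
  assume "computes A f"
  then obtain c where c: "\<And>x. runs A c [x] (f x)" unfolding computes_def by blast
  have "runs A c xs (f (xs ! 0))" if "length xs = 1" for xs
    using that c by (cases xs) auto
  then show "computable A 1 (\<lambda>xs. f (xs ! 0))" unfolding computable_def by blast
next
  assume "computable A 1 (\<lambda>xs. f (xs ! 0))"
  then obtain c where c: "\<And>xs. length xs = 1 \<Longrightarrow> runs A c xs (f (xs ! 0))"
    unfolding computable_def by blast
  from c[of "[_]"] show "computes A f" unfolding computes_def by auto
qed

lemma computable_apply:
  "computes A f \<Longrightarrow> computable A n F \<Longrightarrow> computable A n (\<lambda>xs. f (F xs))"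
  unfolding computes_iff_computable by (rule computable_compose1)

lemma recursive_iff_computes: "recursive f \<longleftrightarrow> computes {} f"
  unfolding recursive_def partial_recursive_def computes_def by (auto dest: runs_deterministic)

fun query_free :: "code \<Rightarrow> code" where
  "query_free Query = Zero"
| "query_free (Comp f gs) = Comp (query_free f) (map query_free gs)"
| "query_free (PrimRec f g) = PrimRec (query_free f) (query_free g)"
| "query_free (Mu f) = Mu (query_free f)"
| "query_free c = c"

text \<open>The empty oracle always answers 0. Only this direction holds in general, since
  \<open>Zero\<close> is defined on lists where \<open>Query\<close> is not.\<close>

lemma runs_query_free: "runs {} c xs y \<Longrightarrow> runs A (query_free c) xs y"
proof (induction rule: runs.induct)
  case (runs_Comp xs gs ys f z)
  then show ?case
    by (auto intro!: runs.runs_Comp[of _ _ _ ys] simp: list_all2_conv_all_nth)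
next
  case (runs_PrimRec_Suc f g n xs y z)
  then show ?case by (auto intro: runs.runs_PrimRec_Suc)
next
  case (runs_Mu n f xs)
  then show ?case by (auto intro!: runs.runs_Mu)
qed (auto intro: runs.intros)

lemma computable_relativize: "computable {} n F \<Longrightarrow> computable A n F"
  unfolding computable_def by (blast intro: runs_query_free)

lemma computes_relativize: "computes {} f \<Longrightarrow> computes A f"
  unfolding computes_iff_computable by (rule computable_relativize)

section \<open>Pairs and tuples\<close>

lemma computable_triangle: "computable A n F \<Longrightarrow> computable A n (\<lambda>xs. triangle (F xs))"
proof -
  assume F: "computable A n F"
  have "rec_nat 0 (\<lambda>k y. y + Suc k) m = triangle m" for m by (induction m) auto
  moreover have "computable A n (\<lambda>xs. rec_nat 0 (\<lambda>k y. y + Suc k) (F xs))"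
    by (intro computable_intros F) simp_all
  ultimately show ?thesis by simp
qed

lemma computable_prod_encode [computable_intros]:
  "computable A n F \<Longrightarrow> computable A n G \<Longrightarrow> computable A n (\<lambda>xs. prod_encode (F xs, G xs))"
  by (simp add: prod_encode_def) (intro computable_intros computable_triangle)

lemma computable_prod_decode:
  shows "computable A 1 (\<lambda>xs. fst (prod_decode (xs ! 0)))"
    and "computable A 1 (\<lambda>xs. snd (prod_decode (xs ! 0)))"
proof -
  \<comment> \<open>Each component is found by minimisation; as both are at most the code, the other
    one needs only a bounded quantifier.\<close>
  have bounds: "fst (prod_decode z) \<le> z \<and> snd (prod_decode z) \<le> z" for z
    by (metis le_prod_encode_1 le_prod_encode_2 prod.collapse prod_decode_inverse)
  have fst_eq: "(LEAST a. \<exists>b\<le>z. prod_encode (a, b) = z) = fst (prod_decode z)" for z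
    using bounds[of z] by (intro Least_equality) (auto intro: exI[of _ "snd (prod_decode z)"])
  have snd_eq: "(LEAST b. \<exists>a\<le>z. prod_encode (a, b) = z) = snd (prod_decode z)" for z
    using bounds[of z] by (intro Least_equality) (auto intro: exI[of _ "fst (prod_decode z)"])
  have "computable A 1 (\<lambda>xs. LEAST a. \<exists>b\<le>xs ! 0. prod_encode (a, b) = xs ! 0)"
    by (rule computable_Least, (intro computable_intros; simp))
      (metis bounds prod.collapse prod_decode_inverse)
  then show "computable A 1 (\<lambda>xs. fst (prod_decode (xs ! 0)))" by (simp add: fst_eq)
  have "computable A 1 (\<lambda>xs. LEAST b. \<exists>a\<le>xs ! 0. prod_encode (a, b) = xs ! 0)"
    by (rule computable_Least, (intro computable_intros; simp))
      (metis bounds prod.collapse prod_decode_inverse)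
  then show "computable A 1 (\<lambda>xs. snd (prod_decode (xs ! 0)))" by (simp add: snd_eq)
qed

lemmas computable_fst_decode [computable_intros] =
  computable_compose1[where f = "\<lambda>z. fst (prod_decode z)", OF computable_prod_decode(1)]

lemmas computable_snd_decode [computable_intros] =
  computable_compose1[where f = "\<lambda>z. snd (prod_decode z)", OF computable_prod_decode(2)]

definition tuple_encode :: "(nat \<Rightarrow> nat) \<Rightarrow> nat \<Rightarrow> nat" where
  "tuple_encode f n = rec_nat 0 (\<lambda>k y. prod_encode (f k, y)) n"

text \<open>Tuples are nested pairs with the last component outermost, so a component can be found only
  if the length of the tuple is known.\<close>

definition tuple_nth :: "nat \<Rightarrow> nat \<Rightarrow> nat \<Rightarrow> nat" where
  "tuple_nth n i c = fst (prod_decode (rec_nat c (\<lambda>k y. snd (prod_decode y)) (n - Suc i)))"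

lemma tuple_nth_encode: "i < n \<Longrightarrow> tuple_nth n i (tuple_encode f n) = f i"
proof -
  \<comment> \<open>Removing the \<open>d\<close> outermost components leaves the tuple of length
    \<open>i\<close>; the induction needs \<open>i\<close> arbitrary.\<close>
  have "rec_nat (tuple_encode f (i + d)) (\<lambda>k y. snd (prod_decode y)) d = tuple_encode f i" for i d
  proof (induction d arbitrary: i)
    case (Suc d)
    show ?case using Suc[of "Suc i"] by (simp add: tuple_encode_def)
  qed simp
  from this[of "Suc i" "n - Suc i"] show "i < n \<Longrightarrow> ?thesis"
    by (simp add: tuple_nth_def tuple_encode_def)
qed

lemma computable_tuple_encode [computable_intros]:
  assumes "computable A (Suc (Suc n)) (\<lambda>l. f (drop 2 l) (l ! 0))" and "computable A n N"
  shows "computable A n (\<lambda>xs. tuple_encode (f xs) (N xs))"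
  unfolding tuple_encode_def by (intro computable_intros assms) simp

lemma computable_tuple_nth [computable_intros]:
  assumes "computable A n M" and "computable A n I" and "computable A n C"
  shows "computable A n (\<lambda>xs. tuple_nth (M xs) (I xs) (C xs))"
  unfolding tuple_nth_def by (intro computable_intros assms) simp

section \<open>Stages of a computation\<close>

text \<open>
  Kleene's bounded simulation relative to the empty set: the value \<open>Suc y\<close> means that the result
  \<open>y\<close> has been found by stage \<open>s\<close>, and \<open>0\<close> that nothing has been found yet. Only the searches need
  to be bounded. For each fixed code this is computable in the stage and the arguments, which
  suffices below and makes a numbering of codes unnecessary.
\<close>

fun stage :: "code \<Rightarrow> nat \<Rightarrow> nat list \<Rightarrow> nat" where
  "stage Zero s xs = 1"
| "stage Succ s xs = (if length xs = 1 then Suc (Suc (xs ! 0)) else 0)"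
| "stage (Proj i) s xs = (if i < length xs then Suc (xs ! i) else 0)"
| "stage Query s xs = (if length xs = 1 then 1 else 0)"
| "stage (Comp f gs) s xs =
    (if \<forall>g\<in>set gs. stage g s xs \<noteq> 0 then stage f s (map (\<lambda>g. stage g s xs - 1) gs) else 0)"
| "stage (PrimRec f g) s xs =
    (if xs = [] then 0
     else rec_nat (stage f s (drop 1 xs))
       (\<lambda>k y. if y = 0 then 0 else stage g s (k # (y - 1) # drop 1 xs)) (xs ! 0))"
| "stage (Mu f) s xs =
    (if \<exists>n<s. stage f s (n # xs) = 1 \<and> (\<forall>i<n. 1 < stage f s (i # xs))
     then Suc (LEAST n. stage f s (n # xs) = 1 \<or> s \<le> n) else 0)"

text \<open>These three equations take the place of the unfolding into \<open>rec_nat\<close>, which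
  is withdrawn from the simplifier after them.\<close>

lemma stage_PrimRec_0: "stage (PrimRec f g) s (0 # zs) = stage f s zs"
  by simp

lemma stage_PrimRec_Suc:
  "stage (PrimRec f g) s (Suc n # zs) = Suc y \<longleftrightarrow>
    (\<exists>w. stage (PrimRec f g) s (n # zs) = Suc w \<and> stage g s (n # w # zs) = Suc y)"
  by (auto simp: gr0_conv_Suc cong del: if_weak_cong)

lemma stage_PrimRec_Nil: "stage (PrimRec f g) s [] = 0"
  by simp

declare stage.simps(6) [simp del]

lemma stage_Mu_iff:
  "stage (Mu f) s xs = Suc y \<longleftrightarrow>
    y < s \<and> stage f s (y # xs) = 1 \<and> (\<forall>i<y. 1 < stage f s (i # xs))"
proof -
  \<comment> \<open>The alternative \<open>s \<le> n\<close> only makes the search total, as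
    \<open>computable_Least\<close> requires; a witness below \<open>s\<close> is found before it
    applies.\<close>
  have "(LEAST n. stage f s (n # xs) = 1 \<or> s \<le> n) = n"
    if "n < s" "stage f s (n # xs) = 1" "\<forall>i<n. 1 < stage f s (i # xs)" for n
    using that by (intro Least_equality) (auto simp: not_less[symmetric])
  then show ?thesis by auto
qed

text \<open>Results are never revised. For \<open>Mu\<close> this is so because all smaller
  candidates must already have been refuted, so that no smaller witness can appear later.\<close>

lemma stage_mono: "stage c s xs = Suc y \<Longrightarrow> s \<le> t \<Longrightarrow> stage c t xs = Suc y"
proof (induction c arbitrary: xs y)
  case (Comp f gs)
  have "stage g t xs = stage g s xs" if "g \<in> set gs" for g
    using Comp.IH(2)[OF that, of xs "stage g s xs - 1"] Comp.prems that
    by (auto split: if_splits)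
  then have "map (\<lambda>g. stage g t xs - 1) gs = map (\<lambda>g. stage g s xs - 1) gs"
    and "(\<forall>g\<in>set gs. stage g t xs \<noteq> 0) \<longleftrightarrow> (\<forall>g\<in>set gs. stage g s xs \<noteq> 0)"
    by auto
  moreover have "\<forall>g\<in>set gs. stage g s xs \<noteq> 0"
    and "stage f s (map (\<lambda>g. stage g s xs - 1) gs) = Suc y"
    using Comp.prems(1) by (auto split: if_splits)
  ultimately show ?case using Comp.IH(1)[OF _ Comp.prems(2)] by (simp only: stage.simps) auto
next
  case (PrimRec f g)
  from PrimRec.prems obtain n zs where xs: "xs = n # zs"
    by (cases xs) (auto simp: stage_PrimRec_Nil)
  have "stage (PrimRec f g) t (n # zs) = Suc y" if "stage (PrimRec f g) s (n # zs) = Suc y" for y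
    using that
  proof (induction n arbitrary: y)
    case 0
    then show ?case using PrimRec.IH(1) PrimRec.prems(2) by (simp add: stage_PrimRec_0)
  next
    case (Suc n)
    then show ?case
      unfolding stage_PrimRec_Suc using PrimRec.IH(2) PrimRec.prems(2) by blast
  qed
  with PrimRec.prems(1) xs show ?case by blast
next
  case (Mu f)
  have "1 < stage f t (i # xs)" if "1 < stage f s (i # xs)" for i
    using Mu.IH[of "i # xs" "stage f s (i # xs) - 1"] Mu.prems(2) that by simp
  then show ?case using Mu.prems Mu.IH[of _ 0] unfolding stage_Mu_iff by auto
qed (auto split: if_splits)

lemma stage_sound: "stage c s xs = Suc y \<Longrightarrow> runs {} c xs y"
proof (induction c arbitrary: xs y)
  case Zero
  then show ?case by (auto intro: runs_Zero)
next
  case Succ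
  then show ?case by (cases xs) (auto intro: runs_Succ split: if_splits)
next
  case (Proj i)
  then show ?case by (auto intro: runs_Proj split: if_splits)
next
  case Query
  then show ?case using runs_Query[of "{}"] by (cases xs) (auto split: if_splits)
next
  case (Comp f gs)
  have "runs {} g xs (stage g s xs - 1)" if "g \<in> set gs" for g
    using Comp.IH(2)[OF that] Comp.prems that by (auto split: if_splits)
  then show ?case
    using Comp.IH(1) Comp.prems
    by (intro runs_Comp[where ys = "map (\<lambda>g. stage g s xs - 1) gs"])
      (auto simp: list_all2_conv_all_nth split: if_splits)
next
  case (PrimRec f g)
  from PrimRec.prems obtain n zs where xs: "xs = n # zs"
    by (cases xs) (auto simp: stage_PrimRec_Nil)
  have "runs {} (PrimRec f g) (n # zs) y" if "stage (PrimRec f g) s (n # zs) = Suc y" for y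
    using that
  proof (induction n arbitrary: y)
    case 0
    then show ?case using PrimRec.IH(1) by (auto simp: stage_PrimRec_0 intro: runs_PrimRec_0)
  next
    case (Suc n)
    then show ?case
      unfolding stage_PrimRec_Suc using PrimRec.IH(2) by (blast intro: runs_PrimRec_Suc)
  qed
  with PrimRec.prems(1) xs show ?case by blast
next
  case (Mu f)
  have y: "stage f s (y # xs) = Suc 0" and less: "\<And>i. i < y \<Longrightarrow> 1 < stage f s (i # xs)"
    using Mu.prems unfolding stage_Mu_iff by auto
  show ?case
  proof (intro runs_Mu allI impI)
    show "runs {} f (y # xs) 0" using y by (rule Mu.IH)
    fix i assume "i < y"
    \<comment> \<open>Results are shifted by one, so a stage value above 1 stands for a positive
      result.\<close>
    then obtain k where "stage f s (i # xs) = Suc (1 + k)"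
      using less_imp_Suc_add[OF less] by blast
    from Mu.IH[OF this] show "\<exists>z. runs {} f (i # xs) (Suc z)" by auto
  qed
qed

text \<open>By monotonicity the maximum of the individual stages works. The bound \<open>s0\<close>
  lets one more requirement on the stage be met at the same time.\<close>

lemma finite_stage_bound:
  assumes "finite I" and "\<And>i. i \<in> I \<Longrightarrow> \<exists>s. stage (c i) s (a i) = Suc (y i)"
  obtains s where "s0 \<le> s" and "\<And>i. i \<in> I \<Longrightarrow> stage (c i) s (a i) = Suc (y i)"
proof -
  obtain t where t: "\<And>i. i \<in> I \<Longrightarrow> stage (c i) (t i) (a i) = Suc (y i)"
    using assms(2) by metis
  show thesis
    by (rule that[of "Max (insert s0 (t ` I))"])
      (use assms(1) in \<open>auto intro!: stage_mono[OF t]\<close>)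
qed

lemma stage_complete: "runs {} c xs y \<Longrightarrow> \<exists>s. stage c s xs = Suc y"
proof (induction rule: runs.induct)
  case (runs_Comp xs gs ys f z)
  obtain s0 where s0: "stage f s0 ys = Suc z" using runs_Comp by blast
  have len: "length gs = length ys"
    and "\<And>i. i < length gs \<Longrightarrow> \<exists>s. stage (gs ! i) s xs = Suc (ys ! i)"
    using runs_Comp(1) by (auto simp: list_all2_conv_all_nth)
  then obtain s where s: "s0 \<le> s" "\<And>i. i < length gs \<Longrightarrow> stage (gs ! i) s xs = Suc (ys ! i)"
    using finite_stage_bound[of "{..<length gs}" "\<lambda>i. gs ! i" "\<lambda>i. xs" "\<lambda>i. ys ! i" s0]
    by auto
  then have "map (\<lambda>g. stage g s xs - 1) gs = ys"
    and "\<forall>g\<in>set gs. stage g s xs \<noteq> 0"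
    by (auto intro!: nth_equalityI simp: len in_set_conv_nth)
  then have "stage (Comp f gs) s xs = stage f s ys" by (simp del: One_nat_def)
  then show ?case using stage_mono[OF s0 s(1)] by metis
next
  case (runs_PrimRec_0 f xs y g)
  then show ?case by (auto simp: stage_PrimRec_0)
next
  case (runs_PrimRec_Suc f g n xs y z)
  then obtain s t where s: "stage (PrimRec f g) s (n # xs) = Suc y"
    and t: "stage g t (n # y # xs) = Suc z" by blast
  have "stage (PrimRec f g) (max s t) (n # xs) = Suc y" "stage g (max s t) (n # y # xs) = Suc z"
    using stage_mono[OF s] stage_mono[OF t] by auto
  then show ?case unfolding stage_PrimRec_Suc by blast
next
  case (runs_Mu n f xs)
  then obtain y where y: "\<And>i. i < n \<Longrightarrow> \<exists>s. stage f s (i # xs) = Suc (Suc (y i))" by metis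
  \<comment> \<open>The value 0 at \<open>n\<close> joins the witness to the refuted candidates, so
    that one stage serves them all.\<close>
  let ?y = "\<lambda>i. if i < n then Suc (y i) else 0"
  have "\<exists>s. stage f s (n # xs) = Suc 0" using runs_Mu by blast
  then have "\<exists>s. stage f s (i # xs) = Suc (?y i)" if "i \<le> n" for i
    using y that by (cases "i = n") auto
  \<comment> \<open>The stage must exceed \<open>n\<close>, since \<open>Mu\<close> at stage
    \<open>s\<close> tries only candidates below \<open>s\<close>.\<close>
  then obtain s where "Suc n \<le> s" "\<And>i. i \<le> n \<Longrightarrow> stage f s (i # xs) = Suc (?y i)"
    using finite_stage_bound[of "{..n}" "\<lambda>i. f" "\<lambda>i. i # xs" ?y "Suc n"] by auto
  then have "stage (Mu f) s xs = Suc n" unfolding stage_Mu_iff by fastforce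
  then show ?case by blast
qed auto

section \<open>Computability of the bounded simulation\<close>

lemma decidable_ball_set:
  "(\<And>g. g \<in> set gs \<Longrightarrow> decidable A n (P g)) \<Longrightarrow> decidable A n (\<lambda>xs. \<forall>g\<in>set gs. P g xs)"
proof (induction gs)
  case Nil
  then show ?case by (simp add: decidable_def computable_const)
next
  case (Cons g gs)
  then show ?case using decidable_conj[of A n "P g" "\<lambda>xs. \<forall>g\<in>set gs. P g xs"] by simp
qed

text \<open>Composition for argument lists built with Cons and \<open>drop\<close> instead of given
  as a list of functions.\<close>

lemma computable_compose_list:
  assumes F: "computable A m F" and len: "\<And>l. length l = n \<Longrightarrow> length (xs l) = m"
    and xs: "\<And>i. i < m \<Longrightarrow> computable A n (\<lambda>l. xs l ! i)"
  shows "computable A n (\<lambda>l. F (xs l))"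
proof -
  have "computable A n (\<lambda>l. F (map (\<lambda>G. G l) (map (\<lambda>i l. xs l ! i) [0..<m])))"
    using F xs by (intro computable_compose) auto
  then show ?thesis
    by (rule computable_cong) (auto simp: len intro!: arg_cong[of _ _ F] nth_equalityI)
qed

lemma computable_Cons_nth:
  assumes "computable A n F" and "\<And>j. i = Suc j \<Longrightarrow> computable A n (\<lambda>l. xs l ! j)"
  shows "computable A n (\<lambda>l. (F l # xs l) ! i)"
  using assms by (cases i) auto

text \<open>Induction on the code, for all arities at once because subcodes are used at other
  arities; where the arity does not fit \<open>Succ\<close>, \<open>Proj\<close>,
  \<open>Query\<close> or \<open>PrimRec\<close>, the function is constantly 0.\<close>

lemma computable_stage: "computable A (Suc n) (\<lambda>l. stage c (l ! 0) (drop 1 l))"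
proof (induction c arbitrary: n)
  case Zero
  then show ?case by (simp add: computable_const)
next
  case Succ
  show ?case
  proof (cases "n = 1")
    case True
    then have "computable A (Suc n) (\<lambda>l. Suc (Suc (drop 1 l ! 0)))"
      by (intro computable_intros) simp
    then show ?thesis by (rule computable_cong) (auto simp: True)
  next
    case False
    then show ?thesis by (intro computable_cong[OF computable_const[of _ _ 0]]) auto
  qed
next
  case (Proj i)
  show ?case
  proof (cases "i < n")
    case True
    then have "computable A (Suc n) (\<lambda>l. Suc (drop 1 l ! i))"
      by (intro computable_intros) simp
    then show ?thesis by (rule computable_cong) (auto simp: True)
  next
    case False
    then show ?thesis by (intro computable_cong[OF computable_const[of _ _ 0]]) auto
  qed
next
  case Query
  then show ?case
    by (intro computable_cong[OF computable_const[of _ _ "if n = 1 then 1 else 0"]]) auto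
next
  case (Comp f gs)
  \<comment> \<open>Putting the stage in front of the intermediate results gives the shape of the
    induction hypothesis for \<open>f\<close>.\<close>
  have "computable A (Suc n)
      (\<lambda>l. stage f ((l ! 0 # map (\<lambda>g. stage g (l ! 0) (drop 1 l) - 1) gs) ! 0)
        (drop 1 (l ! 0 # map (\<lambda>g. stage g (l ! 0) (drop 1 l) - 1) gs)))"
  proof (rule computable_compose_list[where m = "Suc (length gs)"
        and F = "\<lambda>l. stage f (l ! 0) (drop 1 l)"])
    show "computable A (Suc (length gs)) (\<lambda>l. stage f (l ! 0) (drop 1 l))"
      by (rule Comp.IH(1))
    show "computable A (Suc n)
        (\<lambda>l. (l ! 0 # map (\<lambda>g. stage g (l ! 0) (drop 1 l) - 1) gs) ! i)"
      if "i < Suc (length gs)" for i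
      using that Comp.IH(2)[of "gs ! (i - 1)" n]
      by (cases i) (auto intro!: computable_pred[unfolded One_nat_def] computable_nth)
  qed simp
  moreover have "decidable A (Suc n) (\<lambda>l. \<forall>g\<in>set gs. stage g (l ! 0) (drop 1 l) \<noteq> 0)"
    by (intro decidable_ball_set computable_intros Comp.IH(2))
  ultimately have "computable A (Suc n) (\<lambda>l.
      if \<forall>g\<in>set gs. stage g (l ! 0) (drop 1 l) \<noteq> 0
      then stage f (l ! 0) (map (\<lambda>g. stage g (l ! 0) (drop 1 l) - 1) gs) else 0)"
    by (intro computable_if computable_const) auto
  then show ?case by (simp only: stage.simps)
next
  case (PrimRec f g)
  show ?case
  proof (cases n)
    case 0
    then show ?thesis
      by (intro computable_cong[OF computable_const[of _ _ 0]]) (auto simp: stage_PrimRec_Nil)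
  next
    case (Suc m)
    \<comment> \<open>In \<open>l\<close> the stage comes first and the recursion argument second,
      so the parameters begin at position 2.\<close>
    let ?f = "\<lambda>l. stage f (l ! 0) (drop 2 l)"
    let ?g = "\<lambda>k y l. if y = 0 then 0 else stage g (l ! 0) (k # (y - 1) # drop 2 l)"
    have "computable A (Suc (Suc m)) (\<lambda>l. rec_nat (?f l) (\<lambda>k y. ?g k y l) (l ! 1))"
    proof (intro computable_rec computable_if computable_const decidable_eq)
      show "computable A (Suc (Suc m)) (\<lambda>l. stage f (l ! 0) (drop 2 l))"
        by (rule computable_cong[OF computable_compose_list[OF PrimRec.IH(1)[of m],
                of _ "\<lambda>l. l ! 0 # drop 2 l"]])
          (auto intro!: computable_Cons_nth computable_nth computable_nth_drop)
      show "computable A (Suc (Suc (Suc (Suc m))))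
          (\<lambda>l. stage g (drop 2 l ! 0) (l ! 0 # (l ! 1 - 1) # drop 2 (drop 2 l)))"
      proof (rule computable_cong[OF computable_compose_list[OF PrimRec.IH(2)[of "Suc (Suc m)"],
                of _ "\<lambda>l. drop 2 l ! 0 # l ! 0 # (l ! 1 - 1) # drop 2 (drop 2 l)"]])
        show "computable A (Suc (Suc (Suc (Suc m))))
            (\<lambda>l. (drop 2 l ! 0 # l ! 0 # (l ! 1 - 1) # drop 2 (drop 2 l)) ! i)"
          if "i < Suc (Suc (Suc m))" for i
          by (intro computable_Cons_nth computable_intros) (use that in auto)
      qed auto
    qed (auto intro: computable_intros)
    then show ?thesis unfolding Suc
      by (rule computable_cong) (auto simp: stage.simps(6) length_Suc_conv cong del: if_weak_cong)
  qed
next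
  case (Mu f)
  let ?f = "\<lambda>l. \<lambda>k. stage f (l ! 0) (k # drop 1 l)"
  \<comment> \<open>The offset \<open>j\<close> is arbitrary because this is used below minimisation
    and up to two nested quantifiers.\<close>
  have f: "computable A N (\<lambda>l. stage f (S l) (K l # drop j l))"
    if "computable A N S" "computable A N K" "N = j + n" for S K N j
    by (rule computable_cong[OF computable_compose_list[OF Mu.IH[of "Suc n"],
          of _ "\<lambda>l. S l # K l # drop j l"]])
      (use that in \<open>auto intro!: computable_Cons_nth computable_nth_drop\<close>)
  have "computable A (Suc n) (\<lambda>l. if \<exists>k<l ! 0. ?f l k = 1 \<and> (\<forall>i<k. 1 < ?f l i)
      then Suc (LEAST k. ?f l k = 1 \<or> l ! 0 \<le> k) else 0)"
  proof (intro computable_if computable_Suc computable_Least decidable_ex_less decidable_conj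
      decidable_disj decidable_eq decidable_le decidable_all_less decidable_less computable_const)
  qed (auto intro!: f computable_intros)
  then show ?case by (simp only: stage.simps)
qed

section \<open>Partial recursive functions\<close>

definition partial_computable :: "nat \<Rightarrow> (nat list \<Rightarrow> nat option) \<Rightarrow> bool" where
  "partial_computable n P \<longleftrightarrow> (\<exists>c. \<forall>xs y. length xs = n \<longrightarrow> (P xs = Some y \<longleftrightarrow> runs {} c xs y))"

lemma all_length_1: "(\<forall>xs y. length xs = 1 \<longrightarrow> P xs y) \<longleftrightarrow> (\<forall>x y. P [x] y)"
  by (auto simp: length_Suc_conv)

lemma all_length_2: "(\<forall>xs y. length xs = 2 \<longrightarrow> P xs y) \<longleftrightarrow> (\<forall>x x' y. P [x, x'] y)"
  by (auto simp: length_Suc_conv numeral_2_eq_2)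

lemma partial_recursive_iff:
  "partial_recursive \<psi> \<longleftrightarrow> partial_computable 1 (\<lambda>xs. \<psi> (xs ! 0))"
  unfolding partial_recursive_def partial_computable_def all_length_1 by simp

lemma partial_recursive2_iff:
  "partial_recursive2 \<psi> \<longleftrightarrow> partial_computable 2 (\<lambda>xs. \<psi> (xs ! 0) (xs ! 1))"
  unfolding partial_recursive2_def partial_computable_def all_length_2 by simp

text \<open>The total functions \<open>Gs\<close> prepare the arguments, and \<open>H\<close>
  processes the value with access to the original arguments; divergence can come only from
  \<open>P\<close>.\<close>

lemma partial_computable_compose:
  assumes P: "partial_computable (length Gs) P"
    and G: "\<And>G. G \<in> set Gs \<Longrightarrow> computable {} n G"
    and H: "computable {} (Suc n) (\<lambda>l. H (l ! 0) (drop 1 l))"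
  shows "partial_computable n (\<lambda>xs. map_option (\<lambda>y. H y xs) (P (map (\<lambda>G. G xs) Gs)))"
proof -
  obtain p where p: "\<And>xs y. length xs = length Gs \<Longrightarrow> P xs = Some y \<longleftrightarrow> runs {} p xs y"
    using P unfolding partial_computable_def by blast
  obtain g where g: "\<And>G xs. G \<in> set Gs \<Longrightarrow> length xs = n \<Longrightarrow> runs {} (g G) xs (G xs)"
    using G unfolding computable_def by metis
  obtain h where "\<And>l. length l = Suc n \<Longrightarrow> runs {} h l (H (l ! 0) (drop 1 l))"
    using H unfolding computable_def by blast
  from this[of "_ # _"] have h: "\<And>y xs. length xs = n \<Longrightarrow> runs {} h (y # xs) (H y xs)"
    by simp
  let ?Gs = "\<lambda>xs. map (\<lambda>G. G xs) Gs"
  have Gs: "list_all2 (\<lambda>g y. runs {} g xs y) (map g Gs) ys \<longleftrightarrow> ys = ?Gs xs"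
    if "length xs = n" for xs ys
  proof -
    have "runs {} (g G) xs y \<longleftrightarrow> y = G xs" if "G \<in> set Gs" for G y
      using g[OF that \<open>length xs = n\<close>] runs_deterministic by blast
    then show ?thesis by (auto simp: list_all2_conv_all_nth list_eq_iff_nth_eq)
  qed
  have inner: "runs {} (Comp p (map g Gs)) xs y \<longleftrightarrow> P (?Gs xs) = Some y" if "length xs = n" for xs y
    using p[of "?Gs xs"] Gs[OF that] by (auto elim!: runs_CompE intro: runs_Comp)
  have proj: "list_all2 (\<lambda>g y. runs {} g xs y) (map Proj [0..<n]) ys \<longleftrightarrow> ys = xs"
    if "length xs = n" for xs ys
    using that by (auto simp: list_all2_conv_all_nth intro!: nth_equalityI runs_Proj
        elim!: runs_ProjE)
  have "map_option (\<lambda>y. H y xs) (P (?Gs xs)) = Some z \<longleftrightarrow>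
      runs {} (Comp h (Comp p (map g Gs) # map Proj [0..<n])) xs z" if "length xs = n" for xs z
  proof
    assume "map_option (\<lambda>y. H y xs) (P (?Gs xs)) = Some z"
    then obtain y where y: "P (?Gs xs) = Some y" "H y xs = z" by auto
    then show "runs {} (Comp h (Comp p (map g Gs) # map Proj [0..<n])) xs z"
      using inner[OF that] proj[OF that] h[OF that]
      by (intro runs_Comp[where ys = "y # xs"]) auto
  next
    assume "runs {} (Comp h (Comp p (map g Gs) # map Proj [0..<n])) xs z"
    with inner[OF that] proj[OF that] obtain y where "P (?Gs xs) = Some y" "runs {} h (y # xs) z"
      by (auto elim!: runs_CompE simp: list_all2_Cons1)
    then show "map_option (\<lambda>y. H y xs) (P (?Gs xs)) = Some z"
      using runs_deterministic[OF h[OF that]] by simp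
  qed
  then show ?thesis unfolding partial_computable_def by blast
qed

lemma partial_computable_apply:
  assumes "partial_recursive \<psi>" and "computable {} n G"
    and "computable {} (Suc n) (\<lambda>l. H (l ! 0) (drop 1 l))"
  shows "partial_computable n (\<lambda>xs. map_option (\<lambda>y. H y xs) (\<psi> (G xs)))"
  using partial_computable_compose[of "[G]" "\<lambda>xs. \<psi> (xs ! 0)" n H] assms
  by (simp add: partial_recursive_iff)

lemma partial_computable_apply2:
  assumes "partial_recursive2 \<psi>" and "computable {} n F" and "computable {} n G"
    and "computable {} (Suc n) (\<lambda>l. H (l ! 0) (drop 1 l))"
  shows "partial_computable n (\<lambda>xs. map_option (\<lambda>y. H y xs) (\<psi> (F xs) (G xs)))"
  using partial_computable_compose[of "[F, G]" "\<lambda>xs. \<psi> (xs ! 0) (xs ! 1)" n H] assms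
  by (auto simp: partial_recursive2_iff numeral_2_eq_2)

text \<open>The interface to the simulation: the implications below use only these three properties
  of \<open>T\<close>.\<close>

lemma partial_recursive_stages:
  assumes "partial_recursive \<psi>"
  obtains T where "computable {} 2 (\<lambda>l. T (l ! 0) (l ! 1))"
    and "\<And>x y. \<psi> x = Some y \<longleftrightarrow> (\<exists>s. T s x = Suc y)"
    and "\<And>s t x y. T s x = Suc y \<Longrightarrow> s \<le> t \<Longrightarrow> T t x = Suc y"
proof -
  obtain c where c: "\<And>x y. \<psi> x = Some y \<longleftrightarrow> runs {} c [x] y"
    using assms unfolding partial_recursive_def by blast
  show thesis
  proof (rule that[of "\<lambda>s x. stage c s [x]"])
    have "computable {} (Suc 1) (\<lambda>l. stage c (l ! 0) (drop 1 l))" by (rule computable_stage)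
    then have "computable {} 2 (\<lambda>l. stage c (l ! 0) (drop 1 l))"
      by (simp add: numeral_2_eq_2)
    then show "computable {} 2 (\<lambda>l. stage c (l ! 0) [l ! 1])"
      by (rule computable_cong) (auto simp: length_Suc_conv numeral_2_eq_2)
  qed (auto simp: c intro: stage_sound stage_mono dest: stage_complete)
qed

text \<open>The constant family with value \<open>\<psi>\<close> is translated into the numbering,
  and every value of the translation is an index.\<close>

lemma acceptable_numbering_index:
  assumes "acceptable_numbering \<phi>" and "partial_recursive \<psi>"
  obtains e where "\<phi> e = \<psi>"
proof -
  have "partial_recursive2 (\<lambda>e. \<psi>)"
    using partial_computable_apply[OF assms(2), of 2 "\<lambda>xs. xs ! 1" "\<lambda>y xs. y"]
    by (simp add: partial_recursive2_iff computable_nth option.map_ident)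
  then obtain s where "\<And>e. \<phi> (s e) = \<psi>"
    using assms(1) unfolding acceptable_numbering_def by meson
  then show thesis using that by blast
qed

section \<open>Strings and plain complexity\<close>

lemma nat_of_str_of_nat [simp]: "nat_of_str (str_of_nat n) = n"
  unfolding str_of_nat_def by (rule surj_f_inv_f[OF bij_is_surj[OF bij_nat_of_str]])

lemma str_of_nat_of_str [simp]: "str_of_nat (nat_of_str p) = p"
  unfolding str_of_nat_def by (rule inv_f_f[OF bij_is_inj[OF bij_nat_of_str]])

text \<open>The strings of length \<open>k\<close> occupy the numbers from \<open>2 ^ k - 1\<close>
  to \<open>2 ^ (k + 1) - 2\<close>.\<close>

lemma nat_of_str_bounds:
  "2 ^ length p \<le> Suc (nat_of_str p)" "Suc (nat_of_str p) < 2 ^ Suc (length p)"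
  by (induction p) auto

text \<open>Hence the programs shorter than \<open>n\<close> can index the components of a tuple of
  length \<open>2 ^ n\<close>.\<close>

lemma less_power_length: "length p < n \<Longrightarrow> nat_of_str p < 2 ^ n"
proof -
  assume "length p < n"
  then have "(2 :: nat) ^ Suc (length p) \<le> 2 ^ n" by (intro power_increasing) auto
  then show ?thesis using nat_of_str_bounds(2)[of p] by linarith
qed

lemma length_mono: "nat_of_str p \<le> nat_of_str q \<Longrightarrow> length p \<le> length q"
proof (rule ccontr)
  assume le: "nat_of_str p \<le> nat_of_str q" and "\<not> length p \<le> length q"
  then have "(2 :: nat) ^ Suc (length q) \<le> 2 ^ length p" by (intro power_increasing) auto
  then show False using le nat_of_str_bounds(2)[of q] nat_of_str_bounds(1)[of p] by linarith
qed

lemma computable_length [computable_intros]: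
  assumes "computable A n F" shows "computable A n (\<lambda>xs. length (str_of_nat (F xs)))"
proof (rule computable_compose1[OF _ assms])
  \<comment> \<open>The upper bound on the code of a string already determines its length as the
    least exponent that satisfies it.\<close>
  have eq: "(LEAST k. Suc m < 2 * 2 ^ k) = length (str_of_nat m)" for m
  proof (rule Least_equality)
    show "Suc m < 2 * 2 ^ length (str_of_nat m)"
      using nat_of_str_bounds(2)[of "str_of_nat m"] by simp
    fix k assume "Suc m < 2 * 2 ^ k"
    then have "(2 :: nat) ^ length (str_of_nat m) < 2 ^ Suc k"
      using nat_of_str_bounds(1)[of "str_of_nat m"] by simp
    then show "length (str_of_nat m) \<le> k"
      using power_less_imp_less_exp[of "2 :: nat" "length (str_of_nat m)" "Suc k"] by simp
  qed
  have "computable A 1 (\<lambda>xs. LEAST k. Suc (xs ! 0) < 2 * 2 ^ k)"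
  proof (rule computable_Least)
    show "decidable A (Suc 1) (\<lambda>l. Suc (drop 1 l ! 0) < 2 * 2 ^ (l ! 0))"
      by (intro computable_intros) auto
    show "\<exists>k. Suc (xs ! 0) < 2 * 2 ^ k" for xs
      using nat_of_str_bounds(2)[of "str_of_nat (xs ! 0)"] by auto
  qed
  then show "computable A 1 (\<lambda>xs. length (str_of_nat (xs ! 0)))" by (simp add: eq)
qed

lemma str_machine_total:
  assumes "str_recursive V" shows "str_machine (\<lambda>p. Some (str_of_nat (V p)))"
  using assms by (simp add: str_machine_def str_recursive_def recursive_def)

text \<open>With \<open>str_machine_total\<close> this makes the identity a machine, so that every
  string has a description.\<close>

lemma str_recursive_nat_of_str: "str_recursive nat_of_str"
  unfolding str_recursive_def recursive_iff_computes computes_iff_computable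
  by (simp add: computable_nth)

lemma plain_complexity_le: "U p = Some x \<Longrightarrow> plain_complexity U x \<le> length p"
  unfolding plain_complexity_def by (rule Least_le) blast

lemma plain_complexity_machine:
  assumes "universal_machine U" and "str_machine M"
  obtains d where "\<And>p x. M p = Some x \<Longrightarrow> plain_complexity U x \<le> length p + d"
  using assms plain_complexity_le[of U] unfolding universal_machine_def
  by (metis (no_types, lifting) order_trans)

lemma plain_complexity_length:
  assumes "universal_machine U"
  obtains d where "\<And>x. plain_complexity U x \<le> length x + d"
proof -
  from plain_complexity_machine[OF assms str_machine_total[OF str_recursive_nat_of_str]] that
  show thesis by auto
qed

lemma plain_complexity_attained:
  assumes "universal_machine U"
  obtains p where "U p = Some x" and "length p = plain_complexity U x"
proof -
  from str_machine_total[OF str_recursive_nat_of_str] obtain p where "U p = Some x"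
    using assms unfolding universal_machine_def by fastforce
  then have "\<exists>k p. U p = Some x \<and> length p = k" by blast
  from LeastI_ex[OF this] that show thesis unfolding plain_complexity_def by blast
qed

text \<open>There are only finitely many programs of bounded length, and each has at most one
  output.\<close>

lemma finite_plain_complexity_le:
  assumes "universal_machine U" shows "finite {x. plain_complexity U x \<le> b}"
proof (rule finite_subset)
  show "{x. plain_complexity U x \<le> b} \<subseteq> (\<lambda>p. the (U p)) ` {p. length p \<le> b}"
  proof
    fix x assume x: "x \<in> {x. plain_complexity U x \<le> b}"
    obtain p where "U p = Some x" "length p = plain_complexity U x"
      by (rule plain_complexity_attained[OF assms])
    with x show "x \<in> (\<lambda>p. the (U p)) ` {p. length p \<le> b}"
      by (intro image_eqI[of _ _ p]) simp_all
  qed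
  show "finite ((\<lambda>p. the (U p)) ` {p :: bool list. length p \<le> b})"
    using finite_lists_length_le[of "UNIV :: bool set" b] by simp
qed

section \<open>The implications\<close>

lemma eventually_different_imp_high_or_dnr:
  assumes \<phi>: "acceptable_numbering \<phi>" and f: "computes A f"
    and diff: "\<And>h. recursive h \<Longrightarrow> finite {x. f x = h x}"
  shows "high_degree A \<or> dnr_degree \<phi> A"
proof (rule ccontr)
  assume not: "\<not> (high_degree A \<or> dnr_degree \<phi> A)"
  have "partial_recursive2 \<phi>" using \<phi> by (simp add: acceptable_numbering_def)
  from partial_computable_apply2[OF this, of 1 "\<lambda>xs. xs ! 0" "\<lambda>xs. xs ! 0" "\<lambda>y xs. y"]
  have "partial_recursive (\<lambda>x. \<phi> x x)"
    by (simp add: partial_recursive_iff computable_nth option.map_ident)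
  then obtain T where T: "computable {} 2 (\<lambda>l. T (l ! 0) (l ! 1))"
    and T_iff: "\<And>x y. \<phi> x x = Some y \<longleftrightarrow> (\<exists>s. T s x = Suc y)"
    and T_mono: "\<And>s t x y. T s x = Suc y \<Longrightarrow> s \<le> t \<Longrightarrow> T t x = Suc y"
    by (rule partial_recursive_stages) blast
  \<comment> \<open>An agreement of row \<open>n\<close> of \<open>f\<close> with the diagonal
    function is visible at stage \<open>s\<close>; the bound on \<open>x\<close> keeps this
    decidable in \<open>A\<close>.\<close>
  define R where "R n s \<longleftrightarrow> (\<exists>x\<le>s. T s x = Suc (f (prod_encode (n, x))))" for n s
  have R_ex: "\<exists>s. R n s" for n
  proof -
    have "computes A (\<lambda>x. f (prod_encode (n, x)))"
      unfolding computes_iff_computable by (intro computable_apply[OF f] computable_intros) simp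
    then obtain x where "\<phi> x x = Some (f (prod_encode (n, x)))"
      using not unfolding dnr_degree_def dnr_def by metis
    then obtain s where "T s x = Suc (f (prod_encode (n, x)))" using T_iff by blast
    then have "R n (max s x)" unfolding R_def using T_mono by (metis max.cobounded1 max.cobounded2)
    then show ?thesis ..
  qed
  have "computes A (\<lambda>n. LEAST s. R n s)"
    unfolding computes_iff_computable R_def
  proof (rule computable_Least)
    show "decidable A (Suc 1)
        (\<lambda>l. \<exists>x\<le>l ! 0. T (l ! 0) x = Suc (f (prod_encode (drop 1 l ! 0, x))))"
      by (intro computable_apply[OF f] computable_compose2[OF computable_relativize[OF T]]
          computable_intros) simp_all
  qed (use R_ex R_def in blast)
  \<comment> \<open>As \<open>A\<close> is not high, the least-stage function fails to dominate some
    recursive \<open>h\<close>.\<close>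
  then obtain h where h: "recursive h" and inf: "infinite {n. \<not> (LEAST s. R n s) \<ge> h n}"
    using not unfolding high_degree_def dominates_def by blast
  \<comment> \<open>The diagonal function stopped at stage \<open>h n\<close> in row
    \<open>n\<close>; if nothing has been found, truncated subtraction gives the default 0.\<close>
  define k where "k z = T (h (fst (prod_decode z))) (snd (prod_decode z)) - 1" for z
  have "recursive k"
    unfolding recursive_iff_computes computes_iff_computable k_def
    using h[unfolded recursive_iff_computes]
    by (intro computable_pred computable_compose2[OF T] computable_apply[of "{}" h]
        computable_intros) simp_all
  then have fin: "finite {z. f z = k z}" by (rule diff)
  \<comment> \<open>Each row whose agreement is seen by stage \<open>h n\<close> contains a point
    where \<open>f\<close> and \<open>k\<close> agree, so there are only finitely many such
    rows.\<close>
  have "n \<in> (\<lambda>z. fst (prod_decode z)) ` {z. f z = k z}" if "(LEAST s. R n s) \<le> h n" for n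
  proof -
    obtain x where "T (LEAST s. R n s) x = Suc (f (prod_encode (n, x)))"
      using LeastI_ex[OF R_ex[of n]] unfolding R_def by blast
    then have "T (h n) x = Suc (f (prod_encode (n, x)))" using T_mono that by blast
    then show ?thesis by (intro image_eqI[of _ _ "prod_encode (n, x)"]) (auto simp: k_def)
  qed
  then have "{n. \<not> (LEAST s. R n s) \<ge> h n} \<subseteq> (\<lambda>z. fst (prod_decode z)) ` {z. f z = k z}"
    by auto
  with fin inf show False by (meson finite_imageI finite_subset)
qed

lemma dnr_imp_eventually_different:
  assumes \<phi>: "acceptable_numbering \<phi>" and "dnr_degree \<phi> A"
  obtains g where "computes A g"
    and "\<And>\<psi>. partial_recursive \<psi> \<Longrightarrow> finite {x. \<psi> x = Some (g x)}"
proof -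
  obtain f where f: "computes A f" and dnr: "\<And>x y. \<phi> x x = Some y \<Longrightarrow> f x \<noteq> y"
    using assms(2) unfolding dnr_degree_def dnr_def by blast
  \<comment> \<open>Here \<open>p\<close> codes a pair of \<open>n\<close> and \<open>e\<close>, and
    \<open>z\<close> is ignored. Thus the diagonal value at \<open>s p\<close> is component
    \<open>e\<close> of \<open>\<phi> e n\<close>, whatever the number \<open>s p\<close>
    is.\<close>
  define P where "P p z = map_option
    (tuple_nth (Suc (fst (prod_decode p))) (snd (prod_decode p)))
    (\<phi> (snd (prod_decode p)) (fst (prod_decode p)))" for p z :: nat
  have "partial_recursive2 \<phi>" using \<phi> by (simp add: acceptable_numbering_def)
  then have "partial_recursive2 P"
    unfolding partial_recursive2_iff[of P] P_def
    by (rule partial_computable_apply2) (intro computable_intros; simp)+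
  then obtain s where s: "recursive s" and \<phi>_s: "\<And>p. \<phi> (s p) = P p"
    using \<phi> unfolding acceptable_numbering_def by blast
  define g where "g n = tuple_encode (\<lambda>i. f (s (prod_encode (n, i)))) (Suc n)" for n
  show thesis
  proof (rule that)
    show "computes A g"
      unfolding computes_iff_computable g_def
      using s[unfolded recursive_iff_computes, THEN computes_relativize]
      by (intro computable_tuple_encode computable_apply[OF f] computable_apply[of A s]
          computable_intros) simp_all
    fix \<psi> assume "partial_recursive \<psi>"
    then obtain e where e: "\<phi> e = \<psi>" by (rule acceptable_numbering_index[OF \<phi>])
    \<comment> \<open>For \<open>n \<ge> e\<close> the tuple \<open>g n\<close> has a component
      \<open>e\<close>, and there agreement would contradict the DNR property at
      \<open>s (prod_encode (n, e))\<close>.\<close>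
    have "n < e" if "\<psi> n = Some (g n)" for n
    proof (rule ccontr)
      assume "\<not> n < e"
      then have "tuple_nth (Suc n) e (g n) = f (s (prod_encode (n, e)))"
        unfolding g_def by (intro tuple_nth_encode) simp
      then have "\<phi> (s (prod_encode (n, e))) x = Some (f (s (prod_encode (n, e))))" for x
        using that by (simp add: \<phi>_s P_def e)
      with dnr show False by blast
    qed
    then have "{n. \<psi> n = Some (g n)} \<subseteq> {..<e}" by blast
    then show "finite {n. \<psi> n = Some (g n)}" by (rule finite_subset) simp
  qed
qed

lemma computes_tuples:
  assumes "computes A f"
  shows "computes A (\<lambda>n. tuple_encode (\<lambda>i. f (prod_encode (n, i))) (2 ^ n))"
  unfolding computes_iff_computable
  by (intro computable_tuple_encode computable_apply[OF assms] computable_intros) simp_all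

lemma avoids_short_imp_eventually_different:
  assumes avoid: "\<And>V. str_recursive V \<Longrightarrow> finite {n. F n \<in> {V p | p. length p < n}}"
    and h: "recursive h"
  shows "finite {n. F n = h n}"
proof -
  have "str_recursive (\<lambda>p. h (Suc (length p)))"
    unfolding str_recursive_def recursive_iff_computes computes_iff_computable
    by (intro computable_apply[OF h[unfolded recursive_iff_computes]] computable_intros) simp
  then have fin: "finite {n. F n \<in> {h (Suc (length p)) | p :: bool list. length p < n}}"
    by (rule avoid)
  \<comment> \<open>Any string of length \<open>n - 1\<close> outputs \<open>h n\<close>. No string
    is shorter than 0, so \<open>n = 0\<close> is set aside.\<close>
  have "F n \<in> {h (Suc (length p)) | p :: bool list. length p < n}" if "F n = h n" "n \<noteq> 0" for n
    using that by (auto intro!: exI[of _ "replicate (n - 1) True"])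
  then have "{n. F n = h n} \<subseteq>
      insert 0 {n. F n \<in> {h (Suc (length p)) | p :: bool list. length p < n}}"
    by blast
  with fin show ?thesis by (meson finite_insert finite_subset)
qed

section \<open>Unbounded functions below the recursive upper bounds on plain complexity\<close>

lemma high_imp_unbounded_below_upper_bounds:
  assumes U: "universal_machine U" and g: "computes A g"
    and dom: "\<And>h. recursive h \<Longrightarrow> dominates g h"
  shows "\<exists>f. str_computes A f \<and> (\<forall>b. \<exists>x. f x > b) \<and>
    (\<forall>B. recursive_upper_bound U B \<longrightarrow> dominates B f)"
proof -
  have "partial_recursive (\<lambda>n. map_option nat_of_str (U (str_of_nat n)))"
    using U unfolding universal_machine_def str_machine_def by blast
  then obtain T where T: "computable {} 2 (\<lambda>l. T (l ! 0) (l ! 1))"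
    and T_iff: "\<And>x y. map_option nat_of_str (U (str_of_nat x)) = Some y \<longleftrightarrow> (\<exists>s. T s x = Suc y)"
    and T_mono: "\<And>s t x y. T s x = Suc y \<Longrightarrow> s \<le> t \<Longrightarrow> T t x = Suc y"
    by (rule partial_recursive_stages) blast
  \<comment> \<open>A description of length \<open>k\<close> is visible at stage \<open>s\<close>;
    bounding \<open>p\<close> by the same stage makes this both decidable and monotone.\<close>
  define D where "D s n k \<longleftrightarrow> (\<exists>p\<le>s. length (str_of_nat p) = k \<and> T s p = Suc n)" for s n k
  have D_mono: "D t n k" if "D s n k" "s \<le> t" for s t n k
    using that unfolding D_def by (blast intro: T_mono order_trans)
  have D_sound: "plain_complexity U (str_of_nat n) \<le> k" if D: "D s n k" for s n k
  proof -
    obtain p where p: "length (str_of_nat p) = k" "T s p = Suc n" using D unfolding D_def by blast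
    then have "map_option nat_of_str (U (str_of_nat p)) = Some n" using T_iff by blast
    then have "U (str_of_nat p) = Some (str_of_nat n)" by auto
    then show ?thesis using plain_complexity_le p(1) by blast
  qed
  have D_complete: "\<exists>s. D s (nat_of_str x) (plain_complexity U x)" for x
  proof -
    obtain p where p: "U p = Some x" "length p = plain_complexity U x"
      by (rule plain_complexity_attained[OF U])
    then obtain s where "T s (nat_of_str p) = Suc (nat_of_str x)"
      using T_iff[of "nat_of_str p" "nat_of_str x"] by auto
    then have "T (max s (nat_of_str p)) (nat_of_str p) = Suc (nat_of_str x)"
      by (rule T_mono) simp
    then have "D (max s (nat_of_str p)) (nat_of_str x) (plain_complexity U x)"
      unfolding D_def using p(2) by (intro exI[of _ "nat_of_str p"]) simp
    then show ?thesis ..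
  qed
  \<comment> \<open>The candidate \<open>n\<close> makes the minimum exist when no program for \<open>n\<close> has been found yet.\<close>
  define f where "f n = (LEAST k. k = n \<or> D (g n) n k)" for n
  have f_le: "f n \<le> k" if "D (g n) n k" for n k
    unfolding f_def using that by (intro Least_le) blast
  have f_cases: "f n = n \<or> D (g n) n (f n)" for n
    unfolding f_def by (rule LeastI[of _ n]) blast
  show ?thesis
  proof (intro exI[of _ "\<lambda>x. f (nat_of_str x)"] conjI allI impI)
    have "computable A 1 (\<lambda>xs. LEAST k. k = xs ! 0 \<or> D (g (xs ! 0)) (xs ! 0) k)"
      unfolding D_def
      by (rule computable_Least, intro computable_apply[OF g]
          computable_compose2[OF computable_relativize[OF T]] computable_intros) auto
    then show "str_computes A (\<lambda>x. f (nat_of_str x))"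
      by (simp add: str_computes_def computes_iff_computable f_def)
    show "\<exists>x. f (nat_of_str x) > b" for b
    proof (rule ccontr)
      assume "\<nexists>x. f (nat_of_str x) > b"
      then have le: "f n \<le> b" for n by (metis nat_of_str_of_nat not_less)
      \<comment> \<open>If \<open>f\<close> were bounded, every \<open>n\<close> would be small
        itself or have small complexity, which leaves only finitely many \<open>n\<close>.\<close>
      have "n \<in> {..b} \<union> nat_of_str ` {x. plain_complexity U x \<le> b}" for n
        using f_cases[of n] D_sound[of "g n" n "f n"] le[of n]
        by (auto intro!: image_eqI[of _ _ "str_of_nat n"])
      then have "UNIV \<subseteq> {..b} \<union> nat_of_str ` {x. plain_complexity U x \<le> b}" by blast
      then have "finite (UNIV :: nat set)"
        by (rule finite_subset) (simp add: finite_plain_complexity_le[OF U])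
      then show False by simp
    qed
    fix B assume "recursive_upper_bound U B"
    then have B: "computes {} (\<lambda>n. B (str_of_nat n))" and le_B: "\<And>x. plain_complexity U x \<le> B x"
      by (simp_all add: recursive_upper_bound_def str_recursive_def recursive_iff_computes)
    \<comment> \<open>Formulated without \<open>g\<close>, so that the least such stage is a
      recursive function of \<open>n\<close> and is therefore dominated by \<open>g\<close>.\<close>
    define R where "R n s \<longleftrightarrow> (\<exists>p\<le>s. length (str_of_nat p) \<le> B (str_of_nat n) \<and> T s p = Suc n)"
      for n s
    have R_iff: "R n s \<longleftrightarrow> (\<exists>k\<le>B (str_of_nat n). D s n k)" for n s
      unfolding R_def D_def by auto
    have R_ex: "\<exists>s. R n s" for n
      using D_complete[of "str_of_nat n"] le_B[of "str_of_nat n"] unfolding R_iff by auto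
    have "recursive (\<lambda>n. LEAST s. R n s)"
      unfolding recursive_iff_computes computes_iff_computable
    proof (rule computable_Least[OF _ R_ex])
      show "decidable {} (Suc 1) (\<lambda>l. R (drop 1 l ! 0) (l ! 0))"
        unfolding R_def
        by (intro computable_apply[OF B] computable_compose2[OF T] computable_intros) simp_all
    qed
    then have fin: "finite {n. \<not> g n \<ge> (LEAST s. R n s)}"
      using dom unfolding dominates_def by blast
    have "f n \<le> B (str_of_nat n)" if "g n \<ge> (LEAST s. R n s)" for n
    proof -
      obtain k where "k \<le> B (str_of_nat n)" "D (LEAST s. R n s) n k"
        using LeastI_ex[OF R_ex[of n]] unfolding R_iff by blast
      then show ?thesis using f_le D_mono that order_trans by blast
    qed
    then have "{x. \<not> B x \<ge> f (nat_of_str x)} \<subseteq> str_of_nat ` {n. \<not> g n \<ge> (LEAST s. R n s)}"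
      by (auto intro!: image_eqI[of _ _ "nat_of_str _"]) (metis str_of_nat_of_str)
    with fin show "dominates B (\<lambda>x. f (nat_of_str x))"
      unfolding dominates_def by (meson finite_imageI finite_subset)
  qed
qed

lemma partial_different_imp_unbounded_below_upper_bounds:
  assumes U: "universal_machine U" and g: "computes A g"
    and diff: "\<And>\<psi>. partial_recursive \<psi> \<Longrightarrow> finite {x. \<psi> x = Some (g x)}"
  shows "\<exists>f. str_computes A f \<and> (\<forall>b. \<exists>x. f x > b) \<and>
    (\<forall>B. recursive_upper_bound U B \<longrightarrow> dominates B f)"
proof -
  define F where "F n = tuple_encode (\<lambda>i. g (prod_encode (n, i))) (2 ^ n)" for n
  have F: "computes A F" unfolding F_def by (rule computes_tuples[OF g])
  \<comment> \<open>Here \<open>z\<close> codes \<open>n\<close> and a program. The output is read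
    as a pair, and the component of its second entry indexed by the program is returned. A program
    shorter than \<open>n\<close> for the pair of \<open>n\<close> and \<open>F n\<close> thus makes
    \<open>\<psi>\<close> and \<open>g\<close> agree at \<open>z\<close>.\<close>
  define \<psi> where "\<psi> z = map_option
    (\<lambda>y. tuple_nth (2 ^ fst (prod_decode z)) (snd (prod_decode z)) (snd (prod_decode y)))
    (map_option nat_of_str (U (str_of_nat (snd (prod_decode z)))))" for z
  have "partial_recursive (\<lambda>n. map_option nat_of_str (U (str_of_nat n)))"
    using U unfolding universal_machine_def str_machine_def by blast
  then have "partial_recursive \<psi>"
    unfolding partial_recursive_iff[of \<psi>] \<psi>_def
    by (rule partial_computable_apply) (intro computable_intros; simp)+
  then have fin: "finite {z. \<psi> z = Some (g z)}" by (rule diff)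
  let ?bad = "(\<lambda>z. fst (prod_decode z)) ` {z. \<psi> z = Some (g z)}"
  have bad: "n \<in> ?bad" if less: "plain_complexity U (str_of_nat (prod_encode (n, F n))) < n" for n
  proof -
    obtain p where p: "U p = Some (str_of_nat (prod_encode (n, F n)))" "length p < n"
      using plain_complexity_attained[OF U] less by metis
    have "g (prod_encode (n, nat_of_str p)) = tuple_nth (2 ^ n) (nat_of_str p) (F n)"
      using less_power_length[OF p(2)] by (simp add: F_def tuple_nth_encode)
    then show ?thesis
      using p(1) by (intro image_eqI[of _ _ "prod_encode (n, nat_of_str p)"]) (auto simp: \<psi>_def)
  qed
  \<comment> \<open>Only the codes of pairs of \<open>n\<close> and \<open>F n\<close> receive a
    nontrivial lower bound; the default 0 is below every upper bound.\<close>
  define f where "f z = (if F (fst (prod_decode z)) = snd (prod_decode z)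
    then fst (prod_decode z) else 0)" for z
  show ?thesis
  proof (intro exI[of _ "\<lambda>x. f (nat_of_str x)"] conjI allI impI)
    have "computable A 1 (\<lambda>xs. f (xs ! 0))"
      unfolding f_def by (intro computable_intros computable_apply[OF F]) simp_all
    then show "str_computes A (\<lambda>x. f (nat_of_str x))"
      by (simp add: str_computes_def computes_iff_computable)
    show "\<exists>x. f (nat_of_str x) > b" for b
      by (rule exI[of _ "str_of_nat (prod_encode (Suc b, F (Suc b)))"]) (simp add: f_def)
    fix B assume "recursive_upper_bound U B"
    then have le_B: "\<And>x. plain_complexity U x \<le> B x" by (simp add: recursive_upper_bound_def)
    \<comment> \<open>A failure at \<open>x\<close> forces \<open>x\<close> to code \<open>n\<close>
      and \<open>F n\<close> for a bad \<open>n\<close>; since \<open>n\<close> determines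
      \<open>x\<close>, there are finitely many failures.\<close>
    have "x \<in> (\<lambda>n. str_of_nat (prod_encode (n, F n))) ` ?bad" if less: "B x < f (nat_of_str x)" for x
    proof -
      let ?n = "fst (prod_decode (nat_of_str x))"
      have n: "F ?n = snd (prod_decode (nat_of_str x))" "B x < ?n"
        using less by (auto simp: f_def split: if_splits)
      then have x: "x = str_of_nat (prod_encode (?n, F ?n))" by simp
      then have "plain_complexity U (str_of_nat (prod_encode (?n, F ?n))) < ?n"
        using n(2) le_B[of x] by simp
      with x show ?thesis using bad by blast
    qed
    then have "{x. \<not> B x \<ge> f (nat_of_str x)} \<subseteq> (\<lambda>n. str_of_nat (prod_encode (n, F n))) ` ?bad"
      by (auto simp: not_le)
    with fin show "dominates B (\<lambda>x. f (nat_of_str x))"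
      unfolding dominates_def by (meson finite_imageI finite_subset)
  qed
qed

lemma unbounded_below_upper_bounds_imp_avoids_short:
  assumes U: "universal_machine U" and f: "str_computes A f" and unbounded: "\<And>b. \<exists>x. f x > b"
    and dom: "\<And>B. recursive_upper_bound U B \<Longrightarrow> dominates B f"
  shows "\<exists>F. computes A F \<and>
    (\<forall>V. str_recursive V \<longrightarrow> finite {n. F n \<in> {V p | p. length p < n}})"
proof -
  \<comment> \<open>The factor 2 absorbs an additive constant: \<open>length p + d < 2 * n\<close>
    whenever \<open>length p < n\<close> and \<open>d \<le> n\<close>.\<close>
  define F where "F n = (LEAST m. 2 * n \<le> f (str_of_nat m))" for n
  have ex: "\<exists>m. 2 * n \<le> f (str_of_nat m)" for n
    using unbounded[of "2 * n"] by (metis less_imp_le str_of_nat_of_str)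
  have F_large: "2 * n \<le> f (str_of_nat (F n))" for n
    unfolding F_def by (rule LeastI_ex[OF ex])
  show ?thesis
  proof (intro exI[of _ F] conjI allI impI)
    show "computes A F"
      unfolding computes_iff_computable F_def
    proof (rule computable_Least[OF _ ex])
      show "decidable A (Suc 1) (\<lambda>l. 2 * drop 1 l ! 0 \<le> f (str_of_nat (l ! 0)))"
        by (intro computable_intros computable_apply[OF f[unfolded str_computes_def]]) simp_all
    qed
    fix V assume V: "str_recursive V"
    obtain d1 where d1: "\<And>p. plain_complexity U (str_of_nat (V p)) \<le> length p + d1"
      using plain_complexity_machine[OF U str_machine_total[OF V]] by auto
    obtain d2 where d2: "\<And>x. plain_complexity U x \<le> length x + d2"
      using plain_complexity_length[OF U] by auto
    \<comment> \<open>\<open>d1\<close> belongs to descriptions through \<open>V\<close> and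
      \<open>d2\<close> to literal ones; with their sum added, both kinds of candidates for
      \<open>B\<close> are upper bounds.\<close>
    define d where "d = d1 + d2"
    \<comment> \<open>Searching only \<open>j \<le> m\<close> keeps this decidable; a preimage of \<open>m\<close> beyond \<open>m\<close> is at least as
      long as \<open>m\<close> itself.\<close>
    define R where "R m k \<longleftrightarrow> k = length (str_of_nat m) + d \<or>
      (\<exists>j\<le>m. V (str_of_nat j) = m \<and> k = length (str_of_nat j) + d)" for m k
    define B where "B x = (LEAST k. R (nat_of_str x) k)" for x
    have R_ex: "\<exists>k. R m k" for m unfolding R_def by blast
    have B_le: "B (str_of_nat (V p)) \<le> length p + d" for p
    proof (cases "nat_of_str p \<le> V p")
      case True
      then have "R (V p) (length p + d)"
        unfolding R_def by (intro disjI2 exI[of _ "nat_of_str p"]) simp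
      then show ?thesis unfolding B_def by (simp add: Least_le)
    next
      case False
      then have "length (str_of_nat (V p)) \<le> length p" by (intro length_mono) simp
      moreover have "R (V p) (length (str_of_nat (V p)) + d)" unfolding R_def by blast
      then have "B (str_of_nat (V p)) \<le> length (str_of_nat (V p)) + d"
        unfolding B_def by (simp add: Least_le)
      ultimately show ?thesis by linarith
    qed
    have "plain_complexity U x \<le> B x" for x
    proof -
      have "R (nat_of_str x) (B x)" unfolding B_def by (rule LeastI_ex[OF R_ex])
      then show ?thesis
        unfolding R_def d_def using d1 d2[of x]
        by (auto simp: add.assoc) (metis add.assoc le_add1 le_trans str_of_nat_of_str)
    qed
    moreover have "str_recursive B"
      unfolding str_recursive_def recursive_iff_computes computes_iff_computable B_def
        nat_of_str_of_nat
    proof (rule computable_Least[OF _ R_ex])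
      show "decidable {} (Suc 1) (\<lambda>l. R (drop 1 l ! 0) (l ! 0))"
        unfolding R_def
        by (intro computable_intros
            computable_apply[OF V[unfolded str_recursive_def recursive_iff_computes]]) simp_all
    qed
    ultimately have "dominates B f" by (intro dom) (simp add: recursive_upper_bound_def)
    then have fin: "finite {x. \<not> f x \<le> B x}" by (simp add: dominates_def)
    \<comment> \<open>For \<open>n \<ge> d\<close> a hit makes \<open>B\<close> fail to bound
      \<open>f\<close> at the string coded by \<open>F n\<close>. The value of \<open>f\<close>
      there is at least \<open>n\<close>, so each of the finitely many failures accounts for
      finitely many \<open>n\<close>.\<close>
    have "n \<in> {..<d} \<union> (\<Union>x\<in>{x. \<not> f x \<le> B x}. {..f x})" if "F n = V p" "length p < n" for n p
    proof (cases "n < d")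
      case False
      have "B (str_of_nat (F n)) < f (str_of_nat (F n))"
        using B_le[of p] F_large[of n] that False by simp
      moreover have "n \<le> f (str_of_nat (F n))" using F_large[of n] by simp
      ultimately show ?thesis by (auto simp: not_le)
    qed simp
    then have "{n. F n \<in> {V p | p. length p < n}} \<subseteq>
        {..<d} \<union> (\<Union>x\<in>{x. \<not> f x \<le> B x}. {..f x})"
      by blast
    then show "finite {n. F n \<in> {V p | p. length p < n}}"
      by (rule finite_subset) (use fin in simp)
  qed
qed

text \<open>Dominating \<open>h + 1\<close> means being strictly above \<open>h\<close> almost
  everywhere.\<close>

lemma dominates_imp_eventually_different:
  assumes "\<And>h. recursive h \<Longrightarrow> dominates g h" and "recursive h"
  shows "finite {x. g x = h x}"
proof -
  have "recursive (\<lambda>x. Suc (h x))"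
    using assms(2) unfolding recursive_iff_computes computes_iff_computable
    by (rule computable_Suc)
  from assms(1)[OF this] have "finite {x. \<not> g x \<ge> Suc (h x)}" unfolding dominates_def .
  then show ?thesis by (rule rev_finite_subset) auto
qed

theorem theorem5p1:
  fixes \<phi> :: "nat \<Rightarrow> nat \<Rightarrow> nat option"
    and U :: "bool list \<Rightarrow> bool list option"
    and A :: "nat set"
  assumes "acceptable_numbering \<phi>"
    and "universal_machine U"
  shows "let
      S1 = (\<exists>f :: nat \<Rightarrow> nat. computes A f \<and>
              (\<forall>h. recursive h \<longrightarrow> finite {x. f x = h x}));
      S2 = (\<exists>g :: nat \<Rightarrow> nat. computes A g \<and>
              ((\<forall>h. recursive h \<longrightarrow> dominates g h) \<or>
               (\<forall>\<psi>. partial_recursive \<psi> \<longrightarrow> finite {x. \<psi> x = Some (g x)})));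
      S3 = (high_degree A \<or> dnr_degree \<phi> A);
      S4 = (\<exists>f :: bool list \<Rightarrow> nat. str_computes A f \<and> (\<forall>b. \<exists>x. f x > b) \<and>
              (\<forall>B. recursive_upper_bound U B \<longrightarrow> dominates B f));
      S5 = (\<exists>F :: nat \<Rightarrow> nat. computes A F \<and>
              (\<forall>V :: bool list \<Rightarrow> nat. str_recursive V \<longrightarrow>
                finite {n. F n \<in> {V p | p. length p < n}}))
    in (S1 \<longleftrightarrow> S2) \<and> (S2 \<longleftrightarrow> S3) \<and> (S3 \<longleftrightarrow> S4) \<and> (S4 \<longleftrightarrow> S5)"
proof -
  define S1 where "S1 \<longleftrightarrow> (\<exists>f :: nat \<Rightarrow> nat. computes A f \<and>
              (\<forall>h. recursive h \<longrightarrow> finite {x. f x = h x}))"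
  define S2 where "S2 \<longleftrightarrow> (\<exists>g :: nat \<Rightarrow> nat. computes A g \<and>
              ((\<forall>h. recursive h \<longrightarrow> dominates g h) \<or>
               (\<forall>\<psi>. partial_recursive \<psi> \<longrightarrow> finite {x. \<psi> x = Some (g x)})))"
  define S3 where "S3 \<longleftrightarrow> high_degree A \<or> dnr_degree \<phi> A"
  define S4 where "S4 \<longleftrightarrow> (\<exists>f :: bool list \<Rightarrow> nat. str_computes A f \<and> (\<forall>b. \<exists>x. f x > b) \<and>
              (\<forall>B. recursive_upper_bound U B \<longrightarrow> dominates B f))"
  define S5 where "S5 \<longleftrightarrow> (\<exists>F :: nat \<Rightarrow> nat. computes A F \<and>
              (\<forall>V :: bool list \<Rightarrow> nat. str_recursive V \<longrightarrow>
                finite {n. F n \<in> {V p | p. length p < n}}))"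
  have "S1 \<Longrightarrow> S3"
    unfolding S1_def S3_def using eventually_different_imp_high_or_dnr[OF assms(1)] by blast
  moreover have "S3 \<Longrightarrow> S2"
    unfolding S2_def S3_def high_degree_def using dnr_imp_eventually_different[OF assms(1)] by metis
  moreover have "S2 \<Longrightarrow> S1"
  proof -
    assume S2
    then obtain g where g: "computes A g" and
      "(\<forall>h. recursive h \<longrightarrow> dominates g h) \<or>
       (\<forall>\<psi>. partial_recursive \<psi> \<longrightarrow> finite {x. \<psi> x = Some (g x)})"
      unfolding S2_def by blast
    \<comment> \<open>In the second alternative \<open>h\<close> is regarded as the partial
      recursive function \<open>\<lambda>x. Some (h x)\<close>.\<close>
    then have "finite {x. g x = h x}" if "recursive h" for h
      using that dominates_imp_eventually_different[of g h]
        recursive_def[of h] by (auto simp: eq_commute[of "g _"])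
    with g show S1 unfolding S1_def by blast
  qed
  moreover have "S2 \<Longrightarrow> S4"
  proof -
    assume S2
    then obtain g where g: "computes A g" and
      "(\<forall>h. recursive h \<longrightarrow> dominates g h) \<or>
       (\<forall>\<psi>. partial_recursive \<psi> \<longrightarrow> finite {x. \<psi> x = Some (g x)})"
      unfolding S2_def by blast
    then consider (dominating) "\<And>h. recursive h \<Longrightarrow> dominates g h"
      | (different) "\<And>\<psi>. partial_recursive \<psi> \<Longrightarrow> finite {x. \<psi> x = Some (g x)}"
      by blast
    then show S4
    proof cases
      case dominating
      then show S4
        unfolding S4_def by (rule high_imp_unbounded_below_upper_bounds[OF assms(2) g])
    next
      case different
      then show S4
        unfolding S4_def by (rule partial_different_imp_unbounded_below_upper_bounds[OF assms(2) g])
    qed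
  qed
  moreover have "S4 \<Longrightarrow> S5"
  proof -
    assume S4
    then obtain f where f: "str_computes A f" and unbounded: "\<forall>b. \<exists>x. f x > b"
      and dom: "\<forall>B. recursive_upper_bound U B \<longrightarrow> dominates B f"
      unfolding S4_def by (elim exE conjE)
    show S5
      unfolding S5_def
      by (rule unbounded_below_upper_bounds_imp_avoids_short[OF assms(2) f
            unbounded[rule_format] dom[rule_format]])
  qed
  moreover have "S5 \<Longrightarrow> S1"
  proof -
    assume S5
    then obtain F where F: "computes A F"
      and avoid: "\<forall>V. str_recursive V \<longrightarrow> finite {n. F n \<in> {V p | p. length p < n}}"
      unfolding S5_def by (elim exE conjE)
    show S1
      unfolding S1_def
      using F avoids_short_imp_eventually_different[OF avoid[rule_format]]
      by (intro exI[of _ F] conjI allI impI)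
  qed
  ultimately have "(S1 \<longleftrightarrow> S2) \<and> (S2 \<longleftrightarrow> S3) \<and> (S3 \<longleftrightarrow> S4) \<and> (S4 \<longleftrightarrow> S5)"
    by satx
  then show ?thesis
    unfolding Let_def S1_def S2_def S3_def S4_def S5_def .
qed

end
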